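(* Let $A\in\mathbb{R}^{N\times N}$, $B\in\mathbb{R}^{N\times q}$, $x_0\in\mathbb{R}^N$, $T>0$, $x_d\in L^2(0,T;\mathbb{R}^N)$, $Q\in\mathbb{R}^{N\times N}$ symmetric positive semi-definite and $R\in\mathbb{R}^{q\times q}$ symmetric positive definite. There exists a constant $C=C_{[A,B,x_0,Q,R,x_d,T]}$, depending only on $A,B,x_0,Q,R,x_d,T$ (and in particular not on the splitting, the probabilities or the temporal grid), such that the following holds. Let $A=\sum_{m=1}^M A_m$ be any splitting, $(p_\omega)_{\omega=1}^{2^M}$ any probabilities assigned to the subsets of $\{1,\dots,M\}$, and $0=t_0<t_1<\dots<t_K=T$ any temporal grid with maximal spacing $h$, such that (1) $\langle x,A_mx\rangle\le 0$ for all $x\in\mathbb{R}^N$ and all $m\in\{1,\dots,M\}$, and (2) $\sum_{\omega=1}^{2^M}p_\omega=1$ and $\pi_m>0$ for all $m\in\{1,\dots,M\}$. Let $u^*$ be the control that minimizes $J$ over $L^2(0,T;\mathbb{R}^q)$ and, for each $\boldsymbol\omega\in\Omega^K$, let $u_h^*(\boldsymbol\omega)$ be the control that minimizes $J_h(\boldsymbol\omega,\cdot)$ over $L^2(0,T;\mathbb{R}^q)$. Then $$\mathbb{E}\bigl[|J(u_h^* )-J(u^* )|\bigr]\le C\,h\,\mathrm{Var}[\mathcal{A}],$$ where $J(u_h^* )$ denotes the random variable $\boldsymbol\omega\mapsto J(u_h^*(\boldsymbol\omega))$.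
   Context: $|\cdot|$ is the Euclidean norm and $\|\cdot\|$ the induced operator norm of matrices. Randomized splitting. $S_1,\dots,S_{2^M}$ is an enumeration of all subsets of $\{1,\dots,M\}$ (including the empty set); $\Omega=\{1,\dots,2^M\}$. Subset $S_\omega$ is given probability $p_\omega\ge 0$. The probability that index $m$ is selected is $\pi_m=\sum_{\omega:\,m\in S_\omega}p_\omega$. The grid spacings are $h_k=t_k-t_{k-1}$ and $h=\max_k h_k$. For $\boldsymbol\omega=(\omega_1,\dots,\omega_K)\in\Omega^K$ define the piecewise constant matrix $$\mathcal{A}_h(\boldsymbol\omega,t)=\sum_{m\in S_{\omega_k}}\frac{A_m}{\pi_m},\qquad t\in[t_{k-1},t_k).$$ The indices $\omega_k$ are chosen independently, i.e. $\Omega^K$ carries the probabilities $p(\boldsymbol\omega)=p_{\omega_1}p_{\omega_2}\cdots p_{\omega_K}$, and $\mathbb{E}[X]=\sum_{\boldsymbol\omega\in\Omega^K}X(\boldsymbol\omega)p(\boldsymbol\omega)$. Further $$\mathrm{Var}[\mathcal{A}]=\sum_{\omega=1}^{2^M}\Bigl\|\sum_{m\in S_\omega}\frac{A_m}{\pi_m}-A\Bigr\|^2p_\omega .$$ Cost functionals. For $u\in L^2(0,T;\mathbb{R}^q)$ let $x$ solve $\dot x=Ax+Bu$, $x(0)=x_0$, and let $x_h(\boldsymbol\omega,\cdot)$ solve $\dot x_h(\boldsymbol\omega,t)=\mathcal{A}_h(\boldsymbol\omega,t)x_h(\boldsymbol\omega,t)+Bu(t)$, $x_h(\boldsymbol\omega,0)=x_0$.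 Define $$J(u)=\tfrac12\int_0^T\bigl((x(t)-x_d(t))^\top Q(x(t)-x_d(t))+u(t)^\top Ru(t)\bigr)\,dt,$$ $$J_h(\boldsymbol\omega,u)=\tfrac12\int_0^T\bigl((x_h(\boldsymbol\omega,t)-x_d(t))^\top Q(x_h(\boldsymbol\omega,t)-x_d(t))+u(t)^\top Ru(t)\bigr)\,dt.$$ Since $R$ is positive definite, the minimizers of $J$ and of $J_h(\boldsymbol\omega,\cdot)$ exist and are unique. *)

theory Defs
  imports "HOL-Analysis.Analysis"
begin

definition sym_pos_semidef :: "real^'n^'n \<Rightarrow> bool" where
  "sym_pos_semidef Q \<longleftrightarrow> transpose Q = Q \<and> (\<forall>x. 0 \<le> x \<bullet> (Q *v x))"

definition sym_pos_def :: "real^'n^'n \<Rightarrow> bool" where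
  "sym_pos_def R \<longleftrightarrow> transpose R = R \<and> (\<forall>x. x \<noteq> 0 \<longrightarrow> 0 < x \<bullet> (R *v x))"

text \<open>Elements of \<open>L\<^sup>2(0,T)\<close> are represented by functions on the real line. Functions that agree
  almost everywhere on \<open>[0,T]\<close> are not identified, and values outside \<open>[0,T]\<close> are irrelevant.\<close>

definition L2_on :: "real \<Rightarrow> (real \<Rightarrow> real^'n) \<Rightarrow> bool" where
  "L2_on T f \<longleftrightarrow>
     f \<in> borel_measurable (lebesgue_on {0..T}) \<and>
     integrable (lebesgue_on {0..T}) (\<lambda>t. (norm (f t))\<^sup>2)"

text \<open>\<open>x\<close> solves \<open>x'(t) = F(t) x(t) + B u(t)\<close>, \<open>x(0) = x\<^sub>0\<close> on \<open>[0,T]\<close> in the sense of Caratheodory: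
  the coefficient \<open>F\<close> is only piecewise constant and \<open>u\<close> only square integrable, so the differential
  equation is understood in its integrated form.\<close>

definition solves_state_eq ::
  "(real \<Rightarrow> real^'n^'n) \<Rightarrow> real^'q^'n \<Rightarrow> real^'n \<Rightarrow> real \<Rightarrow> (real \<Rightarrow> real^'q) \<Rightarrow> (real \<Rightarrow> real^'n) \<Rightarrow> bool"
where
  "solves_state_eq F B x0 T u x \<longleftrightarrow>
     continuous_on {0..T} x \<and>
     (\<forall>t\<in>{0..T}.
        integrable (lebesgue_on {0..t}) (\<lambda>s. F s *v x s + B *v u s) \<and>
        x t = x0 + (LINT s|lebesgue_on {0..t}. F s *v x s + B *v u s))"

text \<open>The solution is unique on \<open>[0,T]\<close>; only its values outside \<open>[0,T]\<close> depend on the choice.\<close>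

definition state ::
  "(real \<Rightarrow> real^'n^'n) \<Rightarrow> real^'q^'n \<Rightarrow> real^'n \<Rightarrow> real \<Rightarrow> (real \<Rightarrow> real^'q) \<Rightarrow> real \<Rightarrow> real^'n"
where
  "state F B x0 T u = (SOME x. solves_state_eq F B x0 T u x)"

text \<open>The cost of \<open>u\<close> for a time-dependent coefficient \<open>F\<close>: \<open>F = A\<close> constant gives \<open>J\<close>, and
  \<open>F = \<A>\<^sub>h(\<omega>,\<cdot>)\<close> gives \<open>J\<^sub>h(\<omega>,\<cdot>)\<close>.\<close>

definition cost ::
  "(real \<Rightarrow> real^'n^'n) \<Rightarrow> real^'q^'n \<Rightarrow> real^'n \<Rightarrow> real^'n^'n \<Rightarrow> real^'q^'q \<Rightarrow> (real \<Rightarrow> real^'n) \<Rightarrow> real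
     \<Rightarrow> (real \<Rightarrow> real^'q) \<Rightarrow> real"
where
  "cost F B x0 Q R xd T u =
     1/2 * (LINT t|lebesgue_on {0..T}.
        (state F B x0 T u t - xd t) \<bullet> (Q *v (state F B x0 T u t - xd t)) + u t \<bullet> (R *v u t))"

definition enumerates_subsets :: "nat \<Rightarrow> (nat \<Rightarrow> nat set) \<Rightarrow> bool" where
  "enumerates_subsets M S \<longleftrightarrow> bij_betw S {1..2^M} (Pow {1..M})"

definition sel_prob :: "nat \<Rightarrow> (nat \<Rightarrow> nat set) \<Rightarrow> (nat \<Rightarrow> real) \<Rightarrow> nat \<Rightarrow> real" where
  "sel_prob M S p m = (\<Sum>w\<in>{w\<in>{1..2^M}. m \<in> S w}. p w)"

definition sampled_matrix ::
  "nat \<Rightarrow> (nat \<Rightarrow> nat set) \<Rightarrow> (nat \<Rightarrow> real) \<Rightarrow> (nat \<Rightarrow> real^'n^'n) \<Rightarrow> nat \<Rightarrow> real^'n^'n" where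
  "sampled_matrix M S p Am w = (\<Sum>m\<in>S w. (1 / sel_prob M S p m) *\<^sub>R Am m)"

definition Var_split ::
  "nat \<Rightarrow> (nat \<Rightarrow> nat set) \<Rightarrow> (nat \<Rightarrow> real) \<Rightarrow> (nat \<Rightarrow> real^'n^'n) \<Rightarrow> real^'n^'n \<Rightarrow> real" where
  "Var_split M S p Am A =
     (\<Sum>w=1..2^M. (onorm (\<lambda>x. (sampled_matrix M S p Am w - A) *v x))\<^sup>2 * p w)"

definition is_grid :: "real \<Rightarrow> nat \<Rightarrow> (nat \<Rightarrow> real) \<Rightarrow> bool" where
  "is_grid T K \<tau> \<longleftrightarrow> \<tau> 0 = 0 \<and> \<tau> K = T \<and> (\<forall>k\<in>{1..K}. \<tau> (k - 1) < \<tau> k)"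

definition max_spacing :: "nat \<Rightarrow> (nat \<Rightarrow> real) \<Rightarrow> real" where
  "max_spacing K \<tau> = Max ((\<lambda>k. \<tau> k - \<tau> (k - 1)) ` {1..K})"

text \<open>The intervals \<open>[t\<^sub>k\<^sub>-\<^sub>1, t\<^sub>k)\<close> are disjoint, so at most one summand is nonzero. The value outside
  \<open>[0,T)\<close>, in particular at \<open>T\<close>, is \<open>0\<close>.\<close>

definition A_h ::
  "nat \<Rightarrow> (nat \<Rightarrow> nat set) \<Rightarrow> (nat \<Rightarrow> real) \<Rightarrow> (nat \<Rightarrow> real^'n^'n) \<Rightarrow> nat \<Rightarrow> (nat \<Rightarrow> real)
     \<Rightarrow> (nat \<Rightarrow> nat) \<Rightarrow> real \<Rightarrow> real^'n^'n" where
  "A_h M S p Am K \<tau> \<omega> t =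
     (\<Sum>k=1..K. indicator {\<tau> (k - 1)..<\<tau> k} t *\<^sub>R sampled_matrix M S p Am (\<omega> k))"

definition outcomes :: "nat \<Rightarrow> nat \<Rightarrow> (nat \<Rightarrow> nat) set" where
  "outcomes M K = (\<Pi>\<^sub>E k\<in>{1..K}. {1..2^M})"

definition expect :: "nat \<Rightarrow> nat \<Rightarrow> (nat \<Rightarrow> real) \<Rightarrow> ((nat \<Rightarrow> nat) \<Rightarrow> real) \<Rightarrow> real" where
  "expect M K p X = (\<Sum>\<omega>\<in>outcomes M K. X \<omega> * (\<Prod>k=1..K. p (\<omega> k)))"

end

theory Submission
  imports Defs
begin

text \<open>The cost \<open>J\<close> is a strictly convex quadratic functional, so near its minimizer \<open>u\<close> the excess
  \<open>J(w) - J(u)\<close> is of second order in \<open>w - u\<close>. If \<open>w\<close> minimizes \<open>J\<^sub>h\<close>, then coercivity of \<open>R\<close> bounds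
  \<open>w - u\<close> by the difference of the gradients of \<open>J\<^sub>h\<close> and \<open>J\<close> at the deterministic control \<open>u\<close>, and
  this difference is expressed by the errors \<open>x\<^sub>h - x\<close> of the state and \<open>\<chi>\<^sub>h - \<chi>\<close> of the adjoint
  state with the deterministic source \<open>Q (x - x\<^sub>d)\<close> (\<open>minimizer_cost_difference\<close>). It remains to see that
  both errors are of order \<open>h Var\<close> in mean square. The adjoint equation in reversed time is a state
  equation with transposed samples, so one estimate serves both.

  For that estimate (\<open>mean_square_state_error\<close>) the error \<open>e = x\<^sub>h - x\<close> solves
  \<open>e' = F e + (F - A) x\<close> with dissipative \<open>F\<close>, and hence \<open>|e(t)|\<^sup>2\<close> is at most twice the integral of
  \<open>e \<bullet> (F - A) x\<close>. On the \<open>k\<close>-th cell \<open>F - A\<close> is a centred random matrix that depends only on the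
  \<open>k\<close>-th index. If the \<open>k\<close>-th sample in the equation of \<open>x\<^sub>h\<close> is replaced by its mean \<open>A\<close>, the
  resulting trajectory is independent of the \<open>k\<close>-th index and contributes nothing to the expectation,
  while the replacement moves the trajectory only by \<open>O(h)\<close> times the norm of the \<open>k\<close>-th deviation.
  The product of this with the deviation in the pairing has expectation of order \<open>h Var\<close>.

  Dissipativity makes every a priori bound independent of the size of the coefficient, which is what
  keeps the constant free of the splitting and of the probabilities. Dependence on the control is
  removed by comparing \<open>u\<close> with the zero control (\<open>minimizer_L1_bound\<close>).\<close>

section \<open>Primitives of integrable functions\<close>

text \<open>An absolutely continuous function is carried together with a density, in the integrated form
  in which states are defined, so that almost everywhere differentiability is never used.\<close>

definition primitive_on :: "real \<Rightarrow> (real \<Rightarrow> 'a::euclidean_space) \<Rightarrow> (real \<Rightarrow> 'a) \<Rightarrow> bool" where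
  "primitive_on T f x \<longleftrightarrow> integrable (lebesgue_on {0..T}) f \<and>
     (\<forall>t\<in>{0..T}. x t = x 0 + (LINT s|lebesgue_on {0..t}. f s))"

lemma AE_interval_neq: "AE s in lebesgue_on {0..T}. s \<noteq> (c::real)"
proof -
  have "AE s in lebesgue. s \<noteq> c" by (intro AE_completion AE_lborel_singleton)
  then show ?thesis by (subst AE_restrict_space_iff) (auto elim: eventually_mono)
qed

lemma integrable_initial:
  fixes f :: "real \<Rightarrow> 'a::euclidean_space"
  assumes "integrable (lebesgue_on {0..T}) f" "t \<le> T"
  shows "integrable (lebesgue_on {0..t}) f"
  using assms by (intro integrable_subinterval[OF assms(1)]) auto

lemma integral_initial_indicator:
  fixes f :: "real \<Rightarrow> 'a::euclidean_space"
  assumes "s \<le> t"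
  shows "(LINT r|lebesgue_on {0..t}. indicator {..s} r *\<^sub>R f r) = (LINT r|lebesgue_on {0..s}. f r)"
proof -
  have "indicat_real {0..t} r *\<^sub>R indicat_real {..s} r *\<^sub>R f r = indicator {0..s} r *\<^sub>R f r" for r
    using assms by (auto simp: indicator_def)
  then show ?thesis
    by (simp add: integral_restrict_space del: scaleR_scaleR)
qed

lemma primitive_onD:
  assumes "primitive_on T f x"
  shows "integrable (lebesgue_on {0..T}) f"
    and "t \<in> {0..T} \<Longrightarrow> x t - x 0 = (LINT s|lebesgue_on {0..t}. f s)"
    and "t \<in> {0..T} \<Longrightarrow> integrable (lebesgue_on {0..t}) f"
proof -
  show f: "integrable (lebesgue_on {0..T}) f"
    using assms by (simp add: primitive_on_def)
  show "integrable (lebesgue_on {0..t}) f" if "t \<in> {0..T}"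
    using integrable_initial[OF f] that by simp
  show "x t - x 0 = (LINT s|lebesgue_on {0..t}. f s)" if "t \<in> {0..T}"
  proof -
    have "x t = x 0 + (LINT s|lebesgue_on {0..t}. f s)"
      using assms that unfolding primitive_on_def by blast
    then show ?thesis by (metis add_diff_cancel_left')
  qed
qed

lemma primitive_onI:
  assumes "integrable (lebesgue_on {0..T}) f"
    and "\<And>t. t \<in> {0..T} \<Longrightarrow> x t - x 0 = (LINT s|lebesgue_on {0..t}. f s)"
  shows "primitive_on T f x"
  unfolding primitive_on_def using assms by (metis add.commute diff_add_cancel)

lemma primitive_on_continuous:
  fixes f :: "real \<Rightarrow> 'a::euclidean_space"
  assumes "primitive_on T f x"
  shows "continuous_on {0..T} x"
proof -
  have "continuous_on {0..T} (\<lambda>t. x 0 + integral\<^sup>L (lebesgue_on {0..t}) f)"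
    by (intro continuous_intros indefinite_integral_continuous_real primitive_onD(1)[OF assms])
  moreover have "x 0 + integral\<^sup>L (lebesgue_on {0..t}) f = x t" if "t \<in> {0..T}" for t
    unfolding primitive_onD(2)[OF assms that, symmetric] by simp
  ultimately show ?thesis
    by (rule continuous_on_cong[OF refl, THEN iffD1, rotated])
qed

lemma primitive_on_add:
  assumes "primitive_on T f x" "primitive_on T g y"
  shows "primitive_on T (\<lambda>s. f s + g s) (\<lambda>t. x t + y t)"
proof (rule primitive_onI)
  fix t assume t: "t \<in> {0..T}"
  show "x t + y t - (x 0 + y 0) = (LINT s|lebesgue_on {0..t}. f s + g s)"
    using primitive_onD(2,3)[OF assms(1) t] primitive_onD(2,3)[OF assms(2) t]
    by (simp add: add_diff_add)
qed (use primitive_onD(1)[OF assms(1)] primitive_onD(1)[OF assms(2)] in simp)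

lemma primitive_on_scaleR:
  assumes "primitive_on T f x"
  shows "primitive_on T (\<lambda>s. c *\<^sub>R f s) (\<lambda>t. c *\<^sub>R x t)"
proof (rule primitive_onI)
  fix t assume t: "t \<in> {0..T}"
  show "c *\<^sub>R x t - c *\<^sub>R x 0 = (LINT s|lebesgue_on {0..t}. c *\<^sub>R f s)"
    using primitive_onD(2,3)[OF assms(1) t] by (simp flip: scaleR_diff_right)
qed (use primitive_onD(1)[OF assms(1)] in simp)

lemma primitive_on_diff:
  assumes "primitive_on T f x" "primitive_on T g y"
  shows "primitive_on T (\<lambda>s. f s - g s) (\<lambda>t. x t - y t)"
  using primitive_on_add[OF assms(1) primitive_on_scaleR[OF assms(2), of "-1"]] by simp

lemma primitive_on_initial:
  assumes "primitive_on T f x" "t \<le> T"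
  shows "primitive_on t f x"
proof (rule primitive_onI)
  show "integrable (lebesgue_on {0..t}) f"
    by (rule integrable_initial[OF primitive_onD(1)[OF assms(1)] assms(2)])
  show "x s - x 0 = (LINT r|lebesgue_on {0..s}. f r)" if "s \<in> {0..t}" for s
    by (rule primitive_onD(2)[OF assms(1)]) (use that assms(2) in auto)
qed

lemma primitive_on_cong:
  assumes x: "primitive_on T f x"
    and f: "\<And>s. s \<in> {0..T} \<Longrightarrow> f s = g s" and y: "\<And>s. s \<in> {0..T} \<Longrightarrow> x s = y s"
  shows "primitive_on T g y"
proof (rule primitive_onI)
  show "integrable (lebesgue_on {0..T}) g"
    using primitive_onD(1)[OF x] by (rule Bochner_Integration.integrable_cong[THEN iffD1, rotated -1]) (auto simp: f)
  fix t assume t: "t \<in> {0..T}"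
  have "(LINT s|lebesgue_on {0..t}. f s) = (LINT s|lebesgue_on {0..t}. g s)"
    using t f by (intro Bochner_Integration.integral_cong) auto
  then show "y t - y 0 = (LINT s|lebesgue_on {0..t}. g s)"
    using primitive_onD(2)[OF x t] y t by auto
qed

text \<open>The product rule for the pairing of two absolutely continuous functions: by Fubini the
  product of the two total increments is an integral over a square, which the diagonal cuts into
  two triangles, one for each factor that is integrated first.\<close>

lemma primitive_on_inner:
  fixes f g :: "real \<Rightarrow> 'a::euclidean_space"
  assumes x: "primitive_on T f x" and y: "primitive_on T g y" and T: "0 \<le> T"
  shows "x T \<bullet> y T = x 0 \<bullet> y 0 + (LINT s|lebesgue_on {0..T}. f s \<bullet> y s + x s \<bullet> g s)"
    and "integrable (lebesgue_on {0..T}) (\<lambda>s. f s \<bullet> y s)"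
    and "integrable (lebesgue_on {0..T}) (\<lambda>s. x s \<bullet> g s)"
proof -
  define \<mu> where "\<mu> = lebesgue_on {0..T}"
  have [simp]: "space \<mu> = {0..T}" by (simp add: \<mu>_def)
  interpret finite_measure \<mu>
    unfolding \<mu>_def by (rule finite_measure_lebesgue_on) auto
  interpret pair_sigma_finite \<mu> \<mu> ..
  have f[intro,simp]: "integrable \<mu> f" and g[intro,simp]: "integrable \<mu> g"
    using primitive_onD(1)[OF x] primitive_onD(1)[OF y] by (auto simp: \<mu>_def)
  have [measurable]: "f \<in> borel_measurable \<mu>" "g \<in> borel_measurable \<mu>"
    by (auto intro: borel_measurable_integrable)
  have id[measurable]: "(\<lambda>t. t) \<in> borel_measurable \<mu>"
    unfolding \<mu>_def using id_borel_measurable_lebesgue_on[of "{0..T}"] by (simp add: id_def)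
  have cut: "integrable \<mu> (\<lambda>r. indicator {..s} r *\<^sub>R q r)" if q: "integrable \<mu> q" for s and q :: "real \<Rightarrow> 'a"
  proof (rule Bochner_Integration.integrable_bound[OF q])
    have [measurable]: "q \<in> borel_measurable \<mu>" using q by auto
    have "(\<lambda>r. if r \<le> s then q r else 0) \<in> borel_measurable \<mu>" by measurable
    then show "(\<lambda>r. indicator {..s} r *\<^sub>R q r) \<in> borel_measurable \<mu>"
      by (simp add: indicator_scaleR_eq_if)
  qed (auto simp: indicator_def)
  have xs: "(LINT r|\<mu>. indicator {..s} r *\<^sub>R f r) = x s - x 0" if "s \<in> {0..T}" for s
    using primitive_onD(2)[OF x that] that integral_initial_indicator[of s T f] by (auto simp: \<mu>_def)
  have ys: "(LINT r|\<mu>. indicator {..s} r *\<^sub>R g r) = y s - y 0" if "s \<in> {0..T}" for s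
    using primitive_onD(2)[OF y that] that integral_initial_indicator[of s T g] by (auto simp: \<mu>_def)
  have xT: "(LINT r|\<mu>. f r) = x T - x 0" and yT: "(LINT r|\<mu>. g r) = y T - y 0"
    using primitive_onD(2)[OF x, of T] primitive_onD(2)[OF y, of T] T by (auto simp: \<mu>_def)
  have [measurable]: "(\<lambda>(s, r). indicat_real {..s} r) \<in> borel_measurable (\<mu> \<Otimes>\<^sub>M \<mu>)"
  proof -
    have "(\<lambda>p. if snd p \<le> fst p then 1 else 0 :: real) \<in> borel_measurable (\<mu> \<Otimes>\<^sub>M \<mu>)"
      by measurable
    then show ?thesis by (simp add: indicator_def case_prod_beta')
  qed
  have k: "integrable (\<mu> \<Otimes>\<^sub>M \<mu>) (\<lambda>(s, r). f s \<bullet> g r)"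
  proof (rule Fubini_integrable)
    show "(\<lambda>(s, r). f s \<bullet> g r) \<in> borel_measurable (\<mu> \<Otimes>\<^sub>M \<mu>)" by measurable
    show "AE s in \<mu>. integrable \<mu> (\<lambda>r. case (s, r) of (s, r) \<Rightarrow> f s \<bullet> g r)" by simp
    have m: "(\<lambda>s. LINT r|\<mu>. \<bar>f s \<bullet> g r\<bar>) \<in> borel_measurable \<mu>"
      by measurable
    have "integrable \<mu> (\<lambda>s. norm (f s) * (LINT r|\<mu>. norm (g r)))" by simp
    then have "integrable \<mu> (\<lambda>s. LINT r|\<mu>. \<bar>f s \<bullet> g r\<bar>)"
    proof (rule Bochner_Integration.integrable_bound[OF _ m], intro AE_I2)
      fix s
      have "(LINT r|\<mu>. \<bar>f s \<bullet> g r\<bar>) \<le> (LINT r|\<mu>. norm (f s) * norm (g r))"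
        by (intro integral_mono) (auto simp: Cauchy_Schwarz_ineq2)
      then show "norm (LINT r|\<mu>. \<bar>f s \<bullet> g r\<bar>) \<le> norm (norm (f s) * (LINT r|\<mu>. norm (g r)))"
        by simp
    qed
    then show "integrable \<mu> (\<lambda>s. LINT r|\<mu>. norm (case (s, r) of (s, r) \<Rightarrow> f s \<bullet> g r))"
      by simp
  qed
  have k1: "integrable (\<mu> \<Otimes>\<^sub>M \<mu>) (\<lambda>(s, r). indicator {..s} r * (f s \<bullet> g r))"
    by (rule Bochner_Integration.integrable_bound[OF k])
       (auto simp: case_prod_beta' indicator_def)
  have k2: "integrable (\<mu> \<Otimes>\<^sub>M \<mu>) (\<lambda>(s, r). (1 - indicator {..s} r) * (f s \<bullet> g r))"
    by (rule Bochner_Integration.integrable_bound[OF k])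
       (auto simp: case_prod_beta' indicator_def)
  have in1: "(LINT r|\<mu>. indicator {..s} r * (f s \<bullet> g r)) = f s \<bullet> (y s - y 0)" if "s \<in> {0..T}" for s
  proof -
    have "(LINT r|\<mu>. f s \<bullet> (indicator {..s} r *\<^sub>R g r)) = f s \<bullet> (LINT r|\<mu>. indicator {..s} r *\<^sub>R g r)"
      by (intro integral_inner_right cut g)
    then show ?thesis using ys[OF that] by simp
  qed
  have in2: "(LINT s|\<mu>. (1 - indicator {..s} r) * (f s \<bullet> g r)) = (x r - x 0) \<bullet> g r"
    if "r \<in> {0..T}" for r
  proof -
    have "AE s in \<mu>. s \<noteq> r"
      unfolding \<mu>_def by (rule AE_interval_neq)
    then have "(LINT s|\<mu>. (1 - indicator {..s} r) * (f s \<bullet> g r))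
        = (LINT s|\<mu>. (indicator {..r} s *\<^sub>R f s) \<bullet> g r)"
      by (intro integral_cong_AE) (auto simp: indicator_def)
    also have "\<dots> = (LINT s|\<mu>. indicator {..r} s *\<^sub>R f s) \<bullet> g r"
      by (intro integral_inner_left cut f)
    finally show ?thesis using xs[OF that] by simp
  qed
  have i1: "integrable \<mu> (\<lambda>s. f s \<bullet> (y s - y 0))"
    using integrable_fst[OF k1] by (rule Bochner_Integration.integrable_cong[THEN iffD1, rotated -1]) (auto simp: in1)
  have i2: "integrable \<mu> (\<lambda>r. (x r - x 0) \<bullet> g r)"
    using integrable_snd[OF k2] by (rule Bochner_Integration.integrable_cong[THEN iffD1, rotated -1]) (auto simp: in2)
  have j1: "integrable \<mu> (\<lambda>s. f s \<bullet> (y s - y 0) + f s \<bullet> y 0)"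
    using i1 by (intro Bochner_Integration.integrable_add) auto
  then show J1: "integrable (lebesgue_on {0..T}) (\<lambda>s. f s \<bullet> y s)"
    by (simp add: \<mu>_def inner_diff_right)
  have j2: "integrable \<mu> (\<lambda>s. (x s - x 0) \<bullet> g s + x 0 \<bullet> g s)"
    using i2 by (intro Bochner_Integration.integrable_add) auto
  then show J2: "integrable (lebesgue_on {0..T}) (\<lambda>s. x s \<bullet> g s)"
    by (simp add: \<mu>_def inner_diff_left)
  have "(x T - x 0) \<bullet> (y T - y 0) = (LINT s|\<mu>. LINT r|\<mu>. f s \<bullet> g r)"
    using xT yT by simp
  also have "\<dots> = (\<integral>(s, r). f s \<bullet> g r \<partial>(\<mu> \<Otimes>\<^sub>M \<mu>))"
    using integral_fst[OF k] by simp
  also have "\<dots> = (\<integral>(s, r). indicator {..s} r * (f s \<bullet> g r) \<partial>(\<mu> \<Otimes>\<^sub>M \<mu>))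
      + (\<integral>(s, r). (1 - indicator {..s} r) * (f s \<bullet> g r) \<partial>(\<mu> \<Otimes>\<^sub>M \<mu>))"
    unfolding Bochner_Integration.integral_add[OF k1 k2, symmetric]
    by (intro Bochner_Integration.integral_cong) (auto simp: algebra_simps)
  also have "\<dots> = (LINT s|\<mu>. LINT r|\<mu>. indicator {..s} r * (f s \<bullet> g r))
      + (LINT r|\<mu>. LINT s|\<mu>. (1 - indicator {..s} r) * (f s \<bullet> g r))"
    using integral_fst[OF k1] integral_snd[OF k2] by simp
  also have "(LINT s|\<mu>. LINT r|\<mu>. indicator {..s} r * (f s \<bullet> g r)) = (LINT s|\<mu>. f s \<bullet> (y s - y 0))"
    by (intro Bochner_Integration.integral_cong) (auto simp: in1)
  also have "(LINT r|\<mu>. LINT s|\<mu>. (1 - indicator {..s} r) * (f s \<bullet> g r)) = (LINT r|\<mu>. (x r - x 0) \<bullet> g r)"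
    by (intro Bochner_Integration.integral_cong) (auto simp: in2)
  also have "(LINT s|\<mu>. f s \<bullet> (y s - y 0)) = (LINT s|\<mu>. f s \<bullet> y s) - (x T - x 0) \<bullet> y 0"
    using J1 xT by (simp add: inner_diff_right \<mu>_def[symmetric])
  also have "(LINT r|\<mu>. (x r - x 0) \<bullet> g r) = (LINT r|\<mu>. x r \<bullet> g r) - x 0 \<bullet> (y T - y 0)"
    using J2 yT by (simp add: inner_diff_left \<mu>_def[symmetric])
  finally have "x T \<bullet> y T = x 0 \<bullet> y 0 + ((LINT s|\<mu>. f s \<bullet> y s) + (LINT r|\<mu>. x r \<bullet> g r))"
    by (simp add: inner_diff_left inner_diff_right algebra_simps)
  also have "(LINT s|\<mu>. f s \<bullet> y s) + (LINT r|\<mu>. x r \<bullet> g r) = (LINT s|\<mu>. f s \<bullet> y s + x s \<bullet> g s)"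
    using J1 J2 by (simp add: \<mu>_def)
  finally show "x T \<bullet> y T = x 0 \<bullet> y 0 + (LINT s|lebesgue_on {0..T}. f s \<bullet> y s + x s \<bullet> g s)"
    by (simp add: \<mu>_def)
qed

section \<open>Dissipative linear equations\<close>

definition dissipative :: "real^'n^'n \<Rightarrow> bool" where
  "dissipative A \<longleftrightarrow> (\<forall>x. x \<bullet> (A *v x) \<le> 0)"

text \<open>Measurability and the bound \<open>L\<close> are what the existence of solutions needs. Estimates use
  dissipativity alone, and so they do not see the size of the coefficient: the matrices
  \<open>A\<^sub>m / \<pi>\<^sub>m\<close> may be arbitrarily large.\<close>

definition admissible :: "(real \<Rightarrow> real^'n^'n) \<Rightarrow> bool" where
  "admissible F \<longleftrightarrow> F \<in> borel_measurable lebesgue \<and> (\<forall>t. dissipative (F t)) \<and>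
     (\<exists>L. \<forall>t x. norm (F t *v x) \<le> L * norm x)"

lemma norm_matrix_vector_le: "norm (A *v x) \<le> onorm ((*v) A) * norm x" for A :: "real^'n^'m"
  by (rule onorm[OF matrix_vector_mul_bounded_linear])

lemma onorm_matrix_nonneg: "0 \<le> onorm ((*v) A)" for A :: "real^'n^'m"
  by (rule onorm_pos_le[OF matrix_vector_mul_bounded_linear])

lemma borel_measurable_matrix_vector:
  fixes F :: "'a \<Rightarrow> real^'n^'m"
  assumes "F \<in> borel_measurable N" "x \<in> borel_measurable N"
  shows "(\<lambda>s. F s *v x s) \<in> borel_measurable N"
proof (rule borel_measurable_continuous_Pair[OF assms, where H="(*v)"])
  show "continuous_on UNIV (\<lambda>p. fst p *v snd p :: real^'m)"
    unfolding matrix_vector_mult_def by (intro continuous_intros)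
qed

lemma borel_measurable_continuous_interval:
  fixes x :: "real \<Rightarrow> 'a::euclidean_space"
  assumes "continuous_on {a..b} x"
  shows "x \<in> borel_measurable (lebesgue_on {a..b})"
  using continuous_imp_integrable_real[OF assms] by (rule borel_measurable_integrable)

lemma integrable_matrix_vector:
  fixes A :: "real^'n^'m"
  assumes "integrable N x"
  shows "integrable N (\<lambda>s. A *v x s)"
  by (rule integrable_bounded_linear[OF matrix_vector_mul_bounded_linear assms])

lemma integrable_coefficient:
  assumes "admissible F" "continuous_on {0..T} x"
  shows "integrable (lebesgue_on {0..T}) (\<lambda>s. F s *v x s)"
proof -
  obtain L where L: "\<And>t v. norm (F t *v v) \<le> L * norm v"
    using assms(1) by (auto simp: admissible_def)
  have int: "integrable (lebesgue_on {0..T}) (\<lambda>s. L * norm (x s))"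
    by (intro continuous_imp_integrable_real continuous_intros assms)
  show ?thesis
  proof (rule Bochner_Integration.integrable_bound[OF int _ AE_I2])
    show "(\<lambda>s. F s *v x s) \<in> borel_measurable (lebesgue_on {0..T})"
      using assms by (intro borel_measurable_matrix_vector borel_measurable_continuous_interval
          measurable_restrict_space1) (auto simp: admissible_def)
    show "norm (F s *v x s) \<le> norm (L * norm (x s))" for s
      using L[of s "x s"] by simp
  qed
qed

lemma integrable_inner_continuous:
  fixes x :: "real \<Rightarrow> 'a::euclidean_space"
  assumes "continuous_on {0..T} x" "integrable (lebesgue_on {0..T}) b"
  shows "integrable (lebesgue_on {0..T}) (\<lambda>s. x s \<bullet> b s)"
proof -
  have "compact (x ` {0..T})"
    by (intro compact_continuous_image assms(1)) auto
  then obtain C where C: "\<And>s. s \<in> {0..T} \<Longrightarrow> norm (x s) \<le> C"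
    by (meson compact_imp_bounded bounded_iff image_eqI)
  have [measurable]: "x \<in> borel_measurable (lebesgue_on {0..T})" "b \<in> borel_measurable (lebesgue_on {0..T})"
    using assms borel_measurable_continuous_interval by auto
  have "integrable (lebesgue_on {0..T}) (\<lambda>s. C * norm (b s))"
    using assms(2) by simp
  then show ?thesis
  proof (rule Bochner_Integration.integrable_bound)
    show "AE s in lebesgue_on {0..T}. norm (x s \<bullet> b s) \<le> norm (C * norm (b s))"
    proof (rule AE_I2)
      fix s assume "s \<in> space (lebesgue_on {0..T})"
      then have "norm (x s) \<le> C" using C by simp
      then have "\<bar>x s \<bullet> b s\<bar> \<le> C * norm (b s)"
        by (meson Cauchy_Schwarz_ineq2 mult_right_mono norm_ge_zero order.trans)
      then show "norm (x s \<bullet> b s) \<le> norm (C * norm (b s))"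
        by simp
    qed
  qed measurable
qed

text \<open>Dissipativity of the coefficient removes it from the energy balance.\<close>

lemma dissipative_energy:
  fixes b :: "real \<Rightarrow> real^'n"
  assumes F: "\<And>s. dissipative (F s)" and x: "primitive_on T (\<lambda>s. F s *v x s + b s) x"
    and b: "integrable (lebesgue_on {0..T}) b" and t: "t \<in> {0..T}"
  shows "(norm (x t))\<^sup>2 \<le> (norm (x 0))\<^sup>2 + 2 * (LINT s|lebesgue_on {0..t}. x s \<bullet> b s)"
proof -
  define f where "f s = F s *v x s + b s" for s
  have xt: "primitive_on t f x"
    using primitive_on_initial[OF x] t unfolding f_def by simp
  have int: "integrable (lebesgue_on {0..t}) (\<lambda>s. f s \<bullet> x s)" "integrable (lebesgue_on {0..t}) (\<lambda>s. x s \<bullet> f s)"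
    using primitive_on_inner(2,3)[OF xt xt] t by auto
  have xb: "integrable (lebesgue_on {0..t}) (\<lambda>s. x s \<bullet> b s)"
    using primitive_on_continuous[OF xt] integrable_initial[OF b, of t] t
    by (intro integrable_inner_continuous) auto
  have "(norm (x t))\<^sup>2 = (norm (x 0))\<^sup>2 + (LINT s|lebesgue_on {0..t}. f s \<bullet> x s + x s \<bullet> f s)"
    using primitive_on_inner(1)[OF xt xt] t by (simp add: power2_norm_eq_inner)
  also have "(LINT s|lebesgue_on {0..t}. f s \<bullet> x s + x s \<bullet> f s) \<le> (LINT s|lebesgue_on {0..t}. 2 * (x s \<bullet> b s))"
  proof (rule integral_mono)
    fix s
    have "x s \<bullet> (F s *v x s) \<le> 0" using F by (simp add: dissipative_def)
    then show "f s \<bullet> x s + x s \<bullet> f s \<le> 2 * (x s \<bullet> b s)"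
      by (simp add: f_def inner_add_right inner_add_left inner_commute)
  qed (use int xb in auto)
  finally show ?thesis by simp
qed

text \<open>The energy estimate at a point where \<open>norm (x t)\<close> is maximal: one power of the maximum
  cancels, and only the \<open>L\<^sup>1\<close> norm of the source is left.\<close>

lemma dissipative_bound:
  fixes b :: "real \<Rightarrow> real^'n"
  assumes F: "\<And>s. dissipative (F s)" and x: "primitive_on T (\<lambda>s. F s *v x s + b s) x"
    and b: "integrable (lebesgue_on {0..T}) b" and t: "t \<in> {0..T}"
  shows "norm (x t) \<le> norm (x 0) + 2 * (LINT s|lebesgue_on {0..T}. norm (b s))"
proof -
  have "continuous_on {0..T} (\<lambda>t. norm (x t))"
    by (intro continuous_intros primitive_on_continuous[OF x])
  then obtain m where m: "m \<in> {0..T}" "\<And>s. s \<in> {0..T} \<Longrightarrow> norm (x s) \<le> norm (x m)"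
    using continuous_attains_sup[of "{0..T}" "\<lambda>t. norm (x t)"] t by auto
  define N \<beta> where "N = norm (x m)" and "\<beta> = (LINT s|lebesgue_on {0..T}. norm (b s))"
  have "\<beta> \<ge> 0" unfolding \<beta>_def by simp
  have "(LINT s|lebesgue_on {0..m}. x s \<bullet> b s) \<le> (LINT s|lebesgue_on {0..T}. N * norm (b s))"
  proof (rule integral_mono_lebesgue_on_AE)
    show "AE s in lebesgue_on {0..m}. x s \<bullet> b s \<le> N * norm (b s)"
    proof (rule AE_I2)
      fix s assume "s \<in> space (lebesgue_on {0..m})"
      then have "norm (x s) \<le> N" using m by (simp add: N_def)
      then show "x s \<bullet> b s \<le> N * norm (b s)"
        by (meson norm_cauchy_schwarz mult_right_mono norm_ge_zero order.trans)
    qed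
  qed (use b m in \<open>auto simp: N_def\<close>)
  then have "N\<^sup>2 \<le> (norm (x 0))\<^sup>2 + 2 * (N * \<beta>)"
    using dissipative_energy[OF F x b m(1)] by (simp add: N_def \<beta>_def)
  also have "(norm (x 0))\<^sup>2 \<le> N * norm (x 0)"
    using m(2)[of 0] t by (simp add: N_def power2_eq_square mult_right_mono)
  finally have "N * N \<le> N * (norm (x 0) + 2 * \<beta>)"
    by (simp add: power2_eq_square algebra_simps)
  moreover have "N \<ge> 0" by (simp add: N_def)
  ultimately have "N \<le> norm (x 0) + 2 * \<beta>"
    using \<open>\<beta> \<ge> 0\<close> by (cases "N = 0") (auto simp: mult_le_cancel_left)
  then show ?thesis
    using m(2)[OF t] by (simp add: N_def \<beta>_def)
qed

lemma integral_exp_initial: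
  assumes "0 \<le> t" "L \<noteq> (0::real)"
  shows "(LINT s|lebesgue_on {0..t}. exp (L * s)) = (exp (L * t) - 1) / L"
proof -
  have "((\<lambda>s. exp (L * s)) has_integral (exp (L * t) / L - exp (L * 0) / L)) {0..t}"
    using assms
    by (intro fundamental_theorem_of_calculus)
       (auto intro!: derivative_eq_intros simp flip: has_real_derivative_iff_has_vector_derivative)
  moreover have "integrable (lebesgue_on {0..t}) (\<lambda>s. exp (L * s))"
    by (intro continuous_imp_integrable_real continuous_intros)
  ultimately show ?thesis
    by (simp add: lebesgue_integral_eq_integral integral_unique diff_divide_distrib)
qed

text \<open>Picard's fixed point argument. In the variable \<open>exp (- 2 L t) x(t)\<close> the integral operator
  contracts by the factor \<open>1/2\<close> on the whole interval, so that no continuation of local solutions is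
  needed. Composition with the projection of the line onto \<open>{0..T}\<close> places the
  iteration in the complete space of bounded continuous functions on the line.\<close>

lemma integral_equation_solvable:
  fixes F :: "real \<Rightarrow> real^'n^'n"
  assumes F: "admissible F" and G: "continuous_on {0..T} G" and T: "0 \<le> T"
  obtains x where "continuous_on {0..T} x"
    "\<And>t. t \<in> {0..T} \<Longrightarrow> x t = G t + (LINT s|lebesgue_on {0..t}. F s *v x s)"
proof -
  obtain L0 where L0: "\<And>t v. norm (F t *v v) \<le> L0 * norm v"
    using F by (auto simp: admissible_def)
  define L where "L = max 1 L0"
  have L: "L > 0" "norm (F t *v v) \<le> L * norm v" for t v
    using order.trans[OF L0[of t v] mult_right_mono[of L0 "max 1 L0"]] by (auto simp: L_def)
  define W where "W z t = exp (- 2 * L * t) *\<^sub>R (G t + (LINT s|lebesgue_on {0..t}. F s *v (exp (2 * L * s) *\<^sub>R z s)))"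
    for z :: "real \<Rightarrow> real^'n" and t
  define c where "c t = max 0 (min T t)" for t
  have c: "c t \<in> {0..T}" "continuous_on UNIV c" for t
    using T unfolding c_def by (auto intro!: continuous_intros)
  have intz: "integrable (lebesgue_on {0..T}) (\<lambda>s. F s *v (exp (2 * L * s) *\<^sub>R z s))"
    if "continuous_on {0..T} z" for z
    by (intro integrable_coefficient[OF F] continuous_intros that)
  have Wcont: "continuous_on {0..T} (W z)" if "continuous_on {0..T} z" for z
    unfolding W_def by (intro continuous_intros indefinite_integral_continuous_real G intz that)
  have "(\<lambda>t. W z (c t)) \<in> bcontfun" if "continuous_on {0..T} z" for z
  proof -
    have "continuous_on UNIV (\<lambda>t. W z (c t))"
      by (rule continuous_on_compose2[OF Wcont[OF that] c(2)]) (use c(1) in auto)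
    moreover have "compact (W z ` {0..T})"
      by (intro compact_continuous_image Wcont[OF that]) auto
    then have "bounded (range (\<lambda>t. W z (c t)))"
      by (rule bounded_subset[OF compact_imp_bounded]) (use c(1) in auto)
    ultimately show ?thesis by (simp add: bcontfun_def)
  qed
  then have ap: "apply_bcontfun (Bcontfun (\<lambda>t. W z (c t))) t = W z (c t)"
    if "continuous_on {0..T} z" for z t
    using that by (simp add: Bcontfun_inverse)
  define \<Phi> where "\<Phi> z = Bcontfun (\<lambda>t. W (apply_bcontfun z) (c t))" for z
  have \<Phi>: "apply_bcontfun (\<Phi> z) t = W z (c t)" for z t
    unfolding \<Phi>_def by (rule ap) auto
  have contr: "norm (W z t - W y t) \<le> 1/2 * dist z y" if t: "t \<in> {0..T}"
    for z y :: "real \<Rightarrow>\<^sub>C (real^'n)" and t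
  proof -
    let ?d = "dist z y"
    let ?g = "\<lambda>w :: real \<Rightarrow>\<^sub>C (real^'n). \<lambda>s. F s *v (exp (2 * L * s) *\<^sub>R w s)"
    have int: "integrable (lebesgue_on {0..t}) (?g w)" for w
      by (rule integrable_initial[OF intz]) (use t in auto)
    have "W z t - W y t = exp (- 2 * L * t) *\<^sub>R (LINT s|lebesgue_on {0..t}. ?g z s - ?g y s)"
      using int by (simp add: W_def algebra_simps)
    moreover have "norm (LINT s|lebesgue_on {0..t}. ?g z s - ?g y s)
        \<le> (LINT s|lebesgue_on {0..t}. L * ?d * exp (2 * L * s))"
    proof (rule Bochner_Integration.integral_norm_bound_integral)
      show "integrable (lebesgue_on {0..t}) (\<lambda>s. L * ?d * exp (2 * L * s))"
        by (intro continuous_imp_integrable_real continuous_intros)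
      fix s
      have "?g z s - ?g y s = F s *v (exp (2 * L * s) *\<^sub>R (z s - y s))"
        by (simp add: algebra_simps)
      then have "norm (?g z s - ?g y s) \<le> L * (exp (2 * L * s) * norm (z s - y s))"
        using L(2)[of s "exp (2 * L * s) *\<^sub>R (z s - y s)"] by simp
      also have "norm (z s - y s) \<le> ?d"
        using dist_bounded[of z s y] by (simp add: dist_norm)
      finally show "norm (?g z s - ?g y s) \<le> L * ?d * exp (2 * L * s)"
        using L(1) by (simp add: mult_ac)
    qed (use int in auto)
    ultimately have "norm (W z t - W y t)
        \<le> exp (- 2 * L * t) * (L * ?d * ((exp (2 * L * t) - 1) / (2 * L)))"
      using t L(1) integral_exp_initial[of t "2 * L"] by simp
    also have "\<dots> = ?d / 2 * (1 - exp (- 2 * L * t))"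
      using L(1) by (simp add: field_simps exp_minus)
    also have "\<dots> \<le> ?d / 2 * 1"
      by (intro mult_left_mono) auto
    finally show ?thesis by simp
  qed
  have "dist (\<Phi> z) (\<Phi> y) \<le> 1/2 * dist z y" for z y
    by (rule dist_bound) (use contr c(1) in \<open>auto simp: \<Phi> dist_norm\<close>)
  then obtain z where z: "\<Phi> z = z"
    using banach_fix_type[of "1/2" \<Phi>] by auto
  have "W z t = z t" if "t \<in> {0..T}" for t
    using \<Phi>[of z t] that z by (auto simp: c_def)
  then have "exp (2 * L * t) *\<^sub>R z t = exp (2 * L * t) *\<^sub>R W z t" if "t \<in> {0..T}" for t
    using that by simp
  then have "exp (2 * L * t) *\<^sub>R z t = G t + (LINT s|lebesgue_on {0..t}. F s *v (exp (2 * L * s) *\<^sub>R z s))"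
    if "t \<in> {0..T}" for t
    using that by (simp add: W_def flip: exp_add)
  moreover have "continuous_on {0..T} (\<lambda>t. exp (2 * L * t) *\<^sub>R z t)"
    by (intro continuous_intros) auto
  ultimately show thesis using that by blast
qed

subsection \<open>The state\<close>

lemma solves_state_eq_iff_primitive:
  assumes "0 \<le> T"
  shows "solves_state_eq F B x0 T u x \<longleftrightarrow>
    primitive_on T (\<lambda>s. F s *v x s + B *v u s) x \<and> x 0 = x0"
proof
  assume *: "solves_state_eq F B x0 T u x"
  have "x 0 = x0 + (LINT s|lebesgue_on {0..0}. F s *v x s + B *v u s)"
    using * assms unfolding solves_state_eq_def by (meson atLeastAtMost_iff order_refl)
  moreover have "(LINT s|lebesgue_on {0..0}. F s *v x s + B *v u s) = 0"
    by (rule integral_eq_zero_null_sets) simp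
  ultimately have "x 0 = x0" by simp
  have "primitive_on T (\<lambda>s. F s *v x s + B *v u s) x"
  proof (rule primitive_onI)
    show "integrable (lebesgue_on {0..T}) (\<lambda>s. F s *v x s + B *v u s)"
      using * assms unfolding solves_state_eq_def by (meson atLeastAtMost_iff order_refl)
    show "x t - x 0 = (LINT s|lebesgue_on {0..t}. F s *v x s + B *v u s)" if "t \<in> {0..T}" for t
    proof -
      have e: "x t = x0 + (LINT s|lebesgue_on {0..t}. F s *v x s + B *v u s)"
        using * that unfolding solves_state_eq_def by blast
      show ?thesis by (subst e) (simp add: \<open>x 0 = x0\<close>)
    qed
  qed
  then show "primitive_on T (\<lambda>s. F s *v x s + B *v u s) x \<and> x 0 = x0"
    using \<open>x 0 = x0\<close> ..
next
  assume *: "primitive_on T (\<lambda>s. F s *v x s + B *v u s) x \<and> x 0 = x0"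
  then have p: "primitive_on T (\<lambda>s. F s *v x s + B *v u s) x" and "x 0 = x0" by auto
  show "solves_state_eq F B x0 T u x"
    unfolding solves_state_eq_def
  proof (intro conjI ballI)
    show "continuous_on {0..T} x" by (rule primitive_on_continuous[OF p])
    fix t assume t: "t \<in> {0..T}"
    show "integrable (lebesgue_on {0..t}) (\<lambda>s. F s *v x s + B *v u s)"
      by (rule primitive_onD(3)[OF p t])
    show "x t = x0 + (LINT s|lebesgue_on {0..t}. F s *v x s + B *v u s)"
      using primitive_onD(2)[OF p t] \<open>x 0 = x0\<close> by (metis add.commute diff_add_cancel)
  qed
qed

lemma state_primitive:
  assumes F: "admissible F" and T: "0 \<le> T" and u: "integrable (lebesgue_on {0..T}) (\<lambda>s. B *v u s)"
  shows "primitive_on T (\<lambda>s. F s *v state F B x0 T u s + B *v u s) (state F B x0 T u)"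
    and "state F B x0 T u 0 = x0"
proof -
  have "continuous_on {0..T} (\<lambda>t. x0 + (LINT s|lebesgue_on {0..t}. B *v u s))"
    by (intro continuous_intros indefinite_integral_continuous_real u)
  then obtain x where x: "continuous_on {0..T} x" "\<And>t. t \<in> {0..T} \<Longrightarrow>
      x t = x0 + (LINT s|lebesgue_on {0..t}. B *v u s) + (LINT s|lebesgue_on {0..t}. F s *v x s)"
    by (rule integral_equation_solvable[OF F _ T]) blast
  have "solves_state_eq F B x0 T u x"
    unfolding solves_state_eq_def
  proof (intro conjI ballI)
    fix t assume t: "t \<in> {0..T}"
    have 1: "integrable (lebesgue_on {0..t}) (\<lambda>s. F s *v x s)" "integrable (lebesgue_on {0..t}) (\<lambda>s. B *v u s)"
      using t integrable_initial[OF integrable_coefficient[OF F x(1)]] integrable_initial[OF u] by auto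
    show "x t = x0 + (LINT s|lebesgue_on {0..t}. F s *v x s + B *v u s)"
      unfolding Bochner_Integration.integral_add[OF 1] using x(2)[OF t]
      by (simp add: add.assoc add.commute[of "LINT s|lebesgue_on {0..t}. B *v u s"])
    show "integrable (lebesgue_on {0..t}) (\<lambda>s. F s *v x s + B *v u s)"
      using 1 by (rule Bochner_Integration.integrable_add)
  qed (fact x(1))
  then have "solves_state_eq F B x0 T u (state F B x0 T u)"
    unfolding state_def by (rule someI[where P = "solves_state_eq F B x0 T u"])
  then show "primitive_on T (\<lambda>s. F s *v state F B x0 T u s + B *v u s) (state F B x0 T u)"
    "state F B x0 T u 0 = x0"
    by (simp_all add: solves_state_eq_iff_primitive[OF T])
qed

lemma state_unique:
  assumes F: "admissible F" and T: "0 \<le> T" and u: "integrable (lebesgue_on {0..T}) (\<lambda>s. B *v u s)"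
    and y: "primitive_on T (\<lambda>s. F s *v y s + B *v u s) y" "y 0 = x0" and t: "t \<in> {0..T}"
  shows "state F B x0 T u t = y t"
proof -
  let ?x = "state F B x0 T u"
  have "primitive_on T (\<lambda>s. F s *v (?x s - y s) + 0) (\<lambda>s. ?x s - y s)"
    using primitive_on_diff[OF state_primitive(1)[OF F T u, of x0] y(1)]
    by (simp add: matrix_vector_mult_diff_distrib)
  then have "norm (?x t - y t) \<le> norm (?x 0 - y 0) + 2 * (LINT s|lebesgue_on {0..T}. norm (0::real^'a))"
    using F t by (intro dissipative_bound) (auto simp: admissible_def)
  then show ?thesis
    using state_primitive(2)[OF F T u, of x0] y(2) by simp
qed

lemma state_bound:
  assumes "admissible F" "t \<in> {0..T}" "integrable (lebesgue_on {0..T}) (\<lambda>s. B *v u s)"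
  shows "norm (state F B x0 T u t) \<le> norm x0 + 2 * (LINT s|lebesgue_on {0..T}. norm (B *v u s))"
proof -
  have T: "0 \<le> T" using assms(2) by simp
  show ?thesis
    using dissipative_bound[OF _ state_primitive(1)[OF assms(1) T assms(3)] assms(3,2), of x0]
      assms(1) state_primitive(2)[OF assms(1) T assms(3)] by (auto simp: admissible_def)
qed

lemma state_add_scaleR:
  assumes F: "admissible F" and T: "0 \<le> T" and t: "t \<in> {0..T}"
    and u: "integrable (lebesgue_on {0..T}) (\<lambda>s. B *v u s)" and v: "integrable (lebesgue_on {0..T}) (\<lambda>s. B *v v s)"
  shows "state F B x0 T (\<lambda>s. u s + c *\<^sub>R v s) t = state F B x0 T u t + c *\<^sub>R state F B 0 T v t"
proof (rule state_unique[OF F T _ _ _ t])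
  show "integrable (lebesgue_on {0..T}) (\<lambda>s. B *v (u s + c *\<^sub>R v s))"
    using u v by (simp add: matrix_vector_right_distrib matrix_vector_mult_scaleR)
  have "primitive_on T (\<lambda>s. (F s *v state F B x0 T u s + B *v u s) + c *\<^sub>R (F s *v state F B 0 T v s + B *v v s))
    (\<lambda>s. state F B x0 T u s + c *\<^sub>R state F B 0 T v s)"
    by (intro primitive_on_add primitive_on_scaleR state_primitive F T u v)
  then show "primitive_on T (\<lambda>s. F s *v (state F B x0 T u s + c *\<^sub>R state F B 0 T v s) + B *v (u s + c *\<^sub>R v s))
    (\<lambda>s. state F B x0 T u s + c *\<^sub>R state F B 0 T v s)"
    by (simp add: algebra_simps)
qed (simp add: state_primitive(2)[OF F T u] state_primitive(2)[OF F T v])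

lemma linear_inner_matrix: "linear (\<lambda>Y :: real^'n^'m. v \<bullet> (Y *v a))"
  by (rule linearI) (simp_all add: matrix_vector_mult_add_rdistrib inner_add_right scaleR_matrix_vector_assoc[symmetric])

section \<open>Independent sampling\<close>

lemma expect_mono:
  assumes "\<forall>w\<in>{1..2^M}. 0 \<le> p w" "\<And>\<xi>. \<xi> \<in> outcomes M K \<Longrightarrow> X \<xi> \<le> Y \<xi>"
  shows "expect M K p X \<le> expect M K p Y"
  unfolding expect_def
proof (intro sum_mono mult_right_mono prod_nonneg ballI assms(2))
  fix \<xi> k assume "\<xi> \<in> outcomes M K" "k \<in> {1..K}"
  then have "\<xi> k \<in> {1..2^M}" unfolding outcomes_def by (rule PiE_mem)
  then show "0 \<le> p (\<xi> k)" using assms(1) by blast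
qed

lemma expect_add: "expect M K p (\<lambda>\<xi>. X \<xi> + Y \<xi>) = expect M K p X + expect M K p Y"
  unfolding expect_def by (simp add: distrib_right sum.distrib)

lemma expect_cmult: "expect M K p (\<lambda>\<xi>. c * X \<xi>) = c * expect M K p X"
  unfolding expect_def by (simp add: sum_distrib_left mult.assoc)

lemma expect_const:
  assumes "(\<Sum>w=1..2^M. p w) = 1"
  shows "expect M K p (\<lambda>_. c) = c"
proof -
  have "(\<Sum>\<xi>\<in>outcomes M K. \<Prod>k=1..K. p (\<xi> k)) = (\<Prod>k=1..K. \<Sum>w=1..2^M. p w)"
    unfolding outcomes_def by (subst prod_sum_PiE) auto
  then show ?thesis
    unfolding expect_def using assms by (simp flip: sum_distrib_left)
qed

lemma expect_integral:
  assumes "\<And>\<xi>. \<xi> \<in> outcomes M K \<Longrightarrow> integrable N (f \<xi>)"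
  shows "expect M K p (\<lambda>\<xi>. LINT s|N. f \<xi> s) = (LINT s|N. expect M K p (\<lambda>\<xi>. f \<xi> s))"
    and "integrable N (\<lambda>s. expect M K p (\<lambda>\<xi>. f \<xi> s))"
proof -
  show "expect M K p (\<lambda>\<xi>. LINT s|N. f \<xi> s) = (LINT s|N. expect M K p (\<lambda>\<xi>. f \<xi> s))"
    unfolding expect_def using assms by (subst Bochner_Integration.integral_sum) auto
  show "integrable N (\<lambda>s. expect M K p (\<lambda>\<xi>. f \<xi> s))"
    unfolding expect_def by (intro Bochner_Integration.integrable_sum integrable_mult_left assms)
qed

text \<open>Independence enters only in this form: drawing the \<open>k\<close>-th index afresh does not change
  the law.\<close>

lemma expect_resample:
  assumes k: "k \<in> {1..K}" and p: "(\<Sum>w=1..2^M. p w) = 1"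
  shows "expect M K p X = expect M K p (\<lambda>\<xi>. \<Sum>w=1..2^M. p w * X (\<xi>(k := w)))"
proof -
  let ?W = "{1..2^M} :: nat set"
  define J where "J = {1..K} - {k}"
  have J: "{1..K} = insert k J" "k \<notin> J" "finite J" using k by (auto simp: J_def)
  have weight: "(\<Prod>j\<in>insert k J. p ((g(k := v)) j)) = p v * (\<Prod>j\<in>J. p (g j))" for g v
  proof -
    have "(\<Prod>j\<in>J. p ((g(k := v)) j)) = (\<Prod>j\<in>J. p (g j))"
      using J(2) by (intro prod.cong) auto
    then show ?thesis by (simp add: prod.insert[OF J(3,2)])
  qed
  have split: "expect M K p Z = (\<Sum>v\<in>?W. \<Sum>g\<in>J \<rightarrow>\<^sub>E ?W. Z (g(k := v)) * (p v * (\<Prod>j\<in>J. p (g j))))" for Z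
  proof -
    have "expect M K p Z = (\<Sum>x\<in>?W \<times> (J \<rightarrow>\<^sub>E ?W).
        ((\<lambda>\<xi>. Z \<xi> * (\<Prod>j\<in>insert k J. p (\<xi> j))) \<circ> (\<lambda>(v, g). g(k := v))) x)"
      unfolding expect_def outcomes_def J(1) PiE_insert_eq by (rule sum.reindex[OF inj_combinator[OF J(2)]])
    also have "\<dots> = (\<Sum>(v, g)\<in>?W \<times> (J \<rightarrow>\<^sub>E ?W). Z (g(k := v)) * (p v * (\<Prod>j\<in>J. p (g j))))"
      by (rule sum.cong[OF refl]) (simp add: case_prod_beta' weight del: fun_upd_apply)
    finally show ?thesis by (simp add: sum.cartesian_product)
  qed
  have "expect M K p X = (\<Sum>g\<in>J \<rightarrow>\<^sub>E ?W. (\<Sum>w\<in>?W. p w * X (g(k := w))) * (\<Prod>j\<in>J. p (g j)))"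
    by (subst split, subst sum.swap) (simp add: sum_distrib_right sum_distrib_left mult_ac)
  also have "\<dots> = (\<Sum>v\<in>?W. p v) * (\<Sum>g\<in>J \<rightarrow>\<^sub>E ?W. (\<Sum>w\<in>?W. p w * X (g(k := w))) * (\<Prod>j\<in>J. p (g j)))"
    using p by simp
  also have "\<dots> = (\<Sum>v\<in>?W. \<Sum>g\<in>J \<rightarrow>\<^sub>E ?W. p v * ((\<Sum>w\<in>?W. p w * X (g(k := w))) * (\<Prod>j\<in>J. p (g j))))"
    by (rule sum_product)
  also have "\<dots> = expect M K p (\<lambda>\<xi>. \<Sum>w\<in>?W. p w * X (\<xi>(k := w)))"
    unfolding split fun_upd_upd by (intro sum.cong refl) (simp only: mult_ac)
  finally show ?thesis .
qed

lemma expect_coordinate: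
  assumes "k \<in> {1..K}" "(\<Sum>w=1..2^M. p w) = 1"
  shows "expect M K p (\<lambda>\<xi>. g (\<xi> k)) = (\<Sum>w=1..2^M. p w * g w)"
  by (subst expect_resample[OF assms]) (simp add: expect_const[OF assms(2)])

text \<open>A quantity that does not depend on the \<open>k\<close>-th index is orthogonal in mean to the centred
  \<open>k\<close>-th sample.\<close>

lemma expect_centred_zero:
  fixes X :: "nat \<Rightarrow> real^'n^'n"
  assumes k: "k \<in> {1..K}" and p: "(\<Sum>w=1..2^M. p w) = 1"
    and mean: "(\<Sum>w=1..2^M. p w *\<^sub>R X w) = A" and z: "\<And>\<xi> w. z (\<xi>(k := w)) = z \<xi>"
  shows "expect M K p (\<lambda>\<xi>. z \<xi> \<bullet> ((X (\<xi> k) - A) *v a)) = 0"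
proof -
  have zero: "(\<Sum>w=1..2^M. p w * (v \<bullet> ((X w - A) *v a))) = 0" for v
  proof -
    have "v \<bullet> ((\<Sum>w=1..2^M. p w *\<^sub>R X w) *v a) = (\<Sum>w=1..2^M. v \<bullet> ((p w *\<^sub>R X w) *v a))"
      by (rule linear_sum[OF linear_inner_matrix])
    then have "v \<bullet> (A *v a) = (\<Sum>w=1..2^M. p w * (v \<bullet> (X w *v a)))"
      unfolding mean by (simp add: scaleR_matrix_vector_assoc[symmetric])
    then show ?thesis
      using p by (simp add: matrix_vector_mult_diff_rdistrib inner_diff_right right_diff_distrib
          sum_subtractf flip: sum_distrib_right)
  qed
  show ?thesis
    by (subst expect_resample[OF k p]) (simp add: z zero expect_const[OF p] del: One_nat_def)
qed

section \<open>The mean square error of the state\<close>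

text \<open>The cells \<open>I k\<close> are arbitrary sets, because reversing time turns the half-open grid intervals
  into intervals that are open on the other side.\<close>

definition piecewise :: "(nat \<Rightarrow> real set) \<Rightarrow> nat \<Rightarrow> (nat \<Rightarrow> real^'n^'n) \<Rightarrow> real \<Rightarrow> real^'n^'n" where
  "piecewise I K Y t = (\<Sum>k=1..K. indicator (I k) t *\<^sub>R Y k)"

lemma piecewise_mult:
  fixes Y :: "nat \<Rightarrow> real^'n^'n"
  shows "piecewise I K Y t *v v = (\<Sum>k=1..K. indicator (I k) t *\<^sub>R (Y k *v v))"
proof -
  have "linear (\<lambda>Z :: real^'n^'n. Z *v v)"
    by (rule linearI) (simp_all add: algebra_simps scaleR_matrix_vector_assoc[symmetric])
  then have "piecewise I K Y t *v v = (\<Sum>k=1..K. (indicator (I k) t *\<^sub>R Y k) *v v)"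
    unfolding piecewise_def by (rule linear_sum)
  then show ?thesis
    by (simp add: scaleR_matrix_vector_assoc[symmetric])
qed

lemma admissible_piecewise:
  assumes I: "\<And>k. k \<in> {1..K} \<Longrightarrow> I k \<in> sets lebesgue" and Y: "\<And>k. k \<in> {1..K} \<Longrightarrow> dissipative (Y k)"
  shows "admissible (piecewise I K Y)"
  unfolding admissible_def
proof (intro conjI allI exI)
  show "piecewise I K Y \<in> borel_measurable lebesgue"
    unfolding piecewise_def using I
    by (intro borel_measurable_sum borel_measurable_scaleR borel_measurable_indicator) auto
  fix t
  show "dissipative (piecewise I K Y t)"
    unfolding dissipative_def piecewise_mult inner_sum_right
  proof (intro allI sum_nonpos)
    fix x k assume "k \<in> {1..K}"
    then have "x \<bullet> (Y k *v x) \<le> 0" using Y by (auto simp: dissipative_def)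
    then show "x \<bullet> (indicator (I k) t *\<^sub>R (Y k *v x)) \<le> 0" by (simp add: indicator_def)
  qed
  fix x
  have "norm (piecewise I K Y t *v x) \<le> (\<Sum>k=1..K. norm (indicator (I k) t *\<^sub>R (Y k *v x)))"
    unfolding piecewise_mult by (rule norm_sum)
  also have "\<dots> \<le> (\<Sum>k=1..K. onorm ((*v) (Y k)) * norm x)"
    by (intro sum_mono) (auto simp: indicator_def norm_matrix_vector_le onorm_matrix_nonneg)
  finally show "norm (piecewise I K Y t *v x) \<le> (\<Sum>k=1..K. onorm ((*v) (Y k))) * norm x"
    by (simp add: sum_distrib_right)
qed

lemma admissible_const: "dissipative A \<Longrightarrow> admissible (\<lambda>_. A)"
  unfolding admissible_def using norm_matrix_vector_le[of A] by auto

lemma piecewise_at: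
  assumes "k \<in> {1..K}" "t \<in> I k" "\<And>j. j \<in> {1..K} \<Longrightarrow> j \<noteq> k \<Longrightarrow> t \<notin> I j"
  shows "piecewise I K Y t = Y k"
proof -
  have "piecewise I K Y t = (\<Sum>j\<in>{k}. indicator (I j) t *\<^sub>R Y j)"
    unfolding piecewise_def using assms by (intro sum.mono_neutral_right) (auto simp: indicator_def)
  then show ?thesis using assms by simp
qed

lemma primitive_on_state_diff:
  assumes "admissible F" "admissible G" "0 \<le> T" "integrable (lebesgue_on {0..T}) (\<lambda>s. B *v u s)"
  shows "primitive_on T (\<lambda>s. F s *v (state F B x0 T u s - state G B x0 T u s) +
      (F s - G s) *v state G B x0 T u s) (\<lambda>s. state F B x0 T u s - state G B x0 T u s)"
    and "integrable (lebesgue_on {0..T}) (\<lambda>s. (F s - G s) *v state G B x0 T u s)"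
proof -
  show "primitive_on T (\<lambda>s. F s *v (state F B x0 T u s - state G B x0 T u s) +
      (F s - G s) *v state G B x0 T u s) (\<lambda>s. state F B x0 T u s - state G B x0 T u s)"
    using primitive_on_diff[OF state_primitive(1)[OF assms(1,3,4), of x0] state_primitive(1)[OF assms(2,3,4), of x0]]
    by (simp add: algebra_simps)
  have "continuous_on {0..T} (state G B x0 T u)"
    by (rule primitive_on_continuous[OF state_primitive(1)[OF assms(2,3,4)]])
  from integrable_coefficient[OF assms(1) this] integrable_coefficient[OF assms(2) this]
  show "integrable (lebesgue_on {0..T}) (\<lambda>s. (F s - G s) *v state G B x0 T u s)"
    by (simp add: matrix_vector_mult_diff_rdistrib)
qed

text \<open>Put \<open>D = X (\<xi> k) - A\<close>. By the energy balance it suffices to estimate, at each time in the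
  \<open>k\<close>-th cell, the expectation of the error tested against \<open>D *v x\<close>. The error of the trajectory for
  which the \<open>k\<close>-th sample is replaced by its mean \<open>A\<close> does not depend on the \<open>k\<close>-th index and drops
  out. The true trajectory is within \<open>2 h C \<delta>\<close> of the modified one, where \<open>\<delta>\<close> bounds the norm of
  \<open>D\<close>, because the two coefficients differ by \<open>D\<close> on a set of measure at most \<open>h\<close> and agree
  elsewhere. The pairing with \<open>D *v x\<close> contributes the second factor \<open>\<delta>\<close>, so that exactly the second
  moment of \<open>\<delta>\<close> appears.\<close>

lemma mean_square_state_error:
  fixes X :: "nat \<Rightarrow> real^'n^'n" and B :: "real^'q^'n"
  assumes p: "\<forall>w\<in>{1..2^M}. 0 \<le> p w" "(\<Sum>w=1..2^M. p w) = 1"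
    and mean: "(\<Sum>w=1..2^M. p w *\<^sub>R X w) = A"
    and diss: "\<forall>w\<in>{1..2^M}. dissipative (X w)" "dissipative A"
    and \<delta>: "\<forall>w\<in>{1..2^M}. \<forall>v. norm ((X w - A) *v v) \<le> \<delta> w * norm v"
    and I: "\<forall>k\<in>{1..K}. I k \<in> sets lebesgue \<and> I k \<subseteq> {0..T} \<and> measure lebesgue (I k) \<le> h"
    and disj: "\<forall>j\<in>{1..K}. \<forall>k\<in>{1..K}. j \<noteq> k \<longrightarrow> I j \<inter> I k = {}"
    and cover: "AE s in lebesgue_on {0..T}. \<exists>k\<in>{1..K}. s \<in> I k"
    and h: "0 \<le> h" and t: "t \<in> {0..T}"
    and u: "integrable (lebesgue_on {0..T}) (\<lambda>s. B *v u s)"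
    and C: "norm x0 + 2 * (LINT s|lebesgue_on {0..T}. norm (B *v u s)) \<le> C"
  shows "expect M K p (\<lambda>\<xi>. (norm (state (piecewise I K (\<lambda>k. X (\<xi> k))) B x0 T u t
      - state (\<lambda>_. A) B x0 T u t))\<^sup>2) \<le> 4 * C\<^sup>2 * h * T * (\<Sum>w=1..2^M. p w * (\<delta> w)\<^sup>2)"
proof -
  define F where "F \<xi> = piecewise I K (\<lambda>k. X (\<xi> k))" for \<xi>
  define G where "G k \<xi> = piecewise I K ((\<lambda>j. X (\<xi> j))(k := A))" for k \<xi>
  define y where "y H = state H B x0 T u" for H
  define x where "x = y (\<lambda>_. A)"
  define V where "V = (\<Sum>w=1..2^M. p w * (\<delta> w)\<^sup>2)"
  have T: "0 \<le> T" using t by simp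
  have X: "dissipative (X (\<xi> k))" "\<xi> k \<in> {1..2^M}" if "\<xi> \<in> outcomes M K" "k \<in> {1..K}" for \<xi> k
  proof -
    show "\<xi> k \<in> {1..2^M}" using that unfolding outcomes_def by (rule PiE_mem)
    then show "dissipative (X (\<xi> k))" using diss(1) by blast
  qed
  have F: "admissible (F \<xi>)" and G: "admissible (G k \<xi>)" if "\<xi> \<in> outcomes M K" for k \<xi>
    unfolding F_def G_def using I X[OF that] diss(2) by (auto intro!: admissible_piecewise)
  have A: "admissible (\<lambda>_. A)" using diss(2) by (rule admissible_const)
  have ybound: "norm (y H s) \<le> C" if "admissible H" "s \<in> {0..T}" for H s
    using state_bound[OF that u, of x0] C unfolding y_def by linarith
  have C0: "0 \<le> C" using ybound[OF A t] norm_ge_zero order.trans by blast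
  have V0: "0 \<le> V" unfolding V_def using p(1) by (intro sum_nonneg) auto
  have xcont: "continuous_on {0..T} (y H)" if "admissible H" for H
    unfolding y_def by (rule primitive_on_continuous[OF state_primitive(1)[OF that T u]])

  \<comment> \<open>The unit vector shows that the bound \<open>\<delta>\<close> cannot be negative.\<close>
  have \<delta>_nonneg: "0 \<le> \<delta> w" if "w \<in> {1..2^M}" for w
  proof -
    have "norm ((X w - A) *v axis undefined 1) \<le> \<delta> w * norm (axis undefined (1::real) :: real^'n)"
      using \<delta> that by blast
    then show ?thesis
      using norm_ge_zero[of "(X w - A) *v axis undefined 1"] unfolding norm_axis_1 by linarith
  qed
  have near: "norm (y (F \<xi>) s - y (G k \<xi>) s) \<le> 2 * h * \<delta> (\<xi> k) * C"
    if \<xi>: "\<xi> \<in> outcomes M K" and k: "k \<in> {1..K}" and s: "s \<in> {0..T}" for \<xi> k s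
  proof -
    have Gk: "admissible (G k \<xi>)" by (rule G[OF \<xi>])
    let ?b = "\<lambda>r. (F \<xi> r - G k \<xi> r) *v y (G k \<xi>) r"
    have diff: "(F \<xi> r - G k \<xi> r) *v v = indicator (I k) r *\<^sub>R ((X (\<xi> k) - A) *v v)" for r v
    proof -
      have "(F \<xi> r - G k \<xi> r) *v v = (\<Sum>j=1..K. indicator (I j) r *\<^sub>R (X (\<xi> j) *v v) -
          indicator (I j) r *\<^sub>R (((\<lambda>j. X (\<xi> j))(k := A)) j *v v))"
        by (simp add: F_def G_def matrix_vector_mult_diff_rdistrib piecewise_mult sum_subtractf)
      also have "\<dots> = (\<Sum>j\<in>{k}. indicator (I j) r *\<^sub>R (X (\<xi> j) *v v) -
          indicator (I j) r *\<^sub>R (((\<lambda>j. X (\<xi> j))(k := A)) j *v v))"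
        using k by (intro sum.mono_neutral_right) auto
      finally show ?thesis
        by (simp add: matrix_vector_mult_diff_rdistrib scaleR_diff_right)
    qed
    have \<delta>0: "norm ((X (\<xi> k) - A) *v v) \<le> \<delta> (\<xi> k) * norm v" for v
      using \<delta> X(2)[OF \<xi> k] by blast
    have b: "norm (?b r) \<le> \<delta> (\<xi> k) * C * indicator (I k) r" if "r \<in> {0..T}" for r
    proof (cases "r \<in> I k")
      case True
      have "0 \<le> \<delta> (\<xi> k)"
        using \<delta>_nonneg X(2)[OF \<xi> k] by blast
      then show ?thesis
        using order.trans[OF \<delta>0[of "y (G k \<xi>) r"] mult_left_mono[OF ybound[OF G[OF \<xi>] that]]] True
        unfolding diff by simp
    qed (simp add: diff)
    have set: "I k \<in> sets lebesgue" "I k \<subseteq> {0..T}" "measure lebesgue (I k) \<le> h"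
      using I k by auto
    have mI: "(LINT r|lebesgue_on {0..T}. indicat_real (I k) r) = measure lebesgue (I k)"
      and iI: "integrable (lebesgue_on {0..T}) (indicat_real (I k))"
    proof -
      have fin: "finite_measure (lebesgue_on {0..T})" by (rule finite_measure_lebesgue_on) auto
      have m: "I k \<in> sets (lebesgue_on {0..T})" using set by (auto simp: sets_restrict_space)
      show "integrable (lebesgue_on {0..T}) (indicat_real (I k))"
        using m finite_measure.emeasure_finite[OF fin, of "I k"]
        by (intro integrable_real_indicator) (auto simp: less_top)
      show "(LINT r|lebesgue_on {0..T}. indicat_real (I k) r) = measure lebesgue (I k)"
        using m set by (simp add: Int_absorb2 measure_restrict_space)
    qed
    have "norm (y (F \<xi>) s - y (G k \<xi>) s) \<le> 0 + 2 * (LINT r|lebesgue_on {0..T}. norm (?b r))"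
      using dissipative_bound[OF _ primitive_on_state_diff[OF F[OF \<xi>] Gk T u, of x0] s] F[OF \<xi>]
        state_primitive(2)[OF F[OF \<xi>] T u, of x0] state_primitive(2)[OF Gk T u, of x0]
      by (auto simp: y_def admissible_def)
    also have "(LINT r|lebesgue_on {0..T}. norm (?b r)) \<le> (LINT r|lebesgue_on {0..T}. \<delta> (\<xi> k) * C * indicator (I k) r)"
      using primitive_on_state_diff(2)[OF F[OF \<xi>] Gk T u, of x0] iI b
      by (intro integral_mono) (auto simp: y_def)
    also have "\<dots> = \<delta> (\<xi> k) * C * measure lebesgue (I k)"
      using mI by simp
    also have "\<dots> \<le> \<delta> (\<xi> k) * C * h"
    proof -
      have "0 \<le> \<delta> (\<xi> k)"
        using \<delta>_nonneg X(2)[OF \<xi> k] by blast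
      then show ?thesis using C0 set(3) by (intro mult_left_mono) auto
    qed
    finally show ?thesis by (simp add: mult_ac)
  qed

  have pairing: "expect M K p (\<lambda>\<xi>. (y (F \<xi>) s - x s) \<bullet> ((F \<xi> s - A) *v x s)) \<le> 2 * h * C\<^sup>2 * V"
    if k: "k \<in> {1..K}" and sk: "s \<in> I k" for s k
  proof -
    have s: "s \<in> {0..T}" using I k sk by blast
    have Fs: "F \<xi> s = X (\<xi> k)" for \<xi>
      unfolding F_def by (rule piecewise_at[where I=I, OF k sk]) (use k sk disj in blast)
    have "y (G k (\<xi>(k := w))) s - x s = y (G k \<xi>) s - x s" for \<xi> w
    proof -
      have "(\<lambda>j. X ((\<xi>(k := w)) j))(k := A) = (\<lambda>j. X (\<xi> j))(k := A)" by auto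
      then show ?thesis by (simp add: G_def)
    qed
    then have zero: "expect M K p (\<lambda>\<xi>. (y (G k \<xi>) s - x s) \<bullet> ((X (\<xi> k) - A) *v x s)) = 0"
      by (rule expect_centred_zero[OF k p(2) mean])
    have "expect M K p (\<lambda>\<xi>. (y (F \<xi>) s - x s) \<bullet> ((F \<xi> s - A) *v x s)) =
      expect M K p (\<lambda>\<xi>. (y (F \<xi>) s - y (G k \<xi>) s) \<bullet> ((X (\<xi> k) - A) *v x s))
      + expect M K p (\<lambda>\<xi>. (y (G k \<xi>) s - x s) \<bullet> ((X (\<xi> k) - A) *v x s))"
      unfolding expect_add[symmetric] Fs by (simp add: inner_diff_left algebra_simps)
    also have "\<dots> \<le> expect M K p (\<lambda>\<xi>. 2 * h * C\<^sup>2 * (\<delta> (\<xi> k))\<^sup>2)"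
      unfolding zero add_0_right
    proof (rule expect_mono[OF p(1)])
      fix \<xi> assume \<xi>: "\<xi> \<in> outcomes M K"
      let ?d = "\<delta> (\<xi> k)"
      have \<delta>0: "norm ((X (\<xi> k) - A) *v v) \<le> ?d * norm v" for v
        using \<delta> X(2)[OF \<xi> k] by blast
      have d0: "0 \<le> ?d"
        using \<delta>_nonneg X(2)[OF \<xi> k] by blast
      have "norm ((X (\<xi> k) - A) *v x s) \<le> ?d * C"
        using \<delta>0[of "x s"] mult_left_mono[OF ybound[OF A s] d0] unfolding x_def by linarith
      then have "norm (y (F \<xi>) s - y (G k \<xi>) s) * norm ((X (\<xi> k) - A) *v x s) \<le> (2 * h * ?d * C) * (?d * C)"
        using near[OF \<xi> k s] h d0 C0 by (intro mult_mono) auto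
      then show "(y (F \<xi>) s - y (G k \<xi>) s) \<bullet> ((X (\<xi> k) - A) *v x s) \<le> 2 * h * C\<^sup>2 * ?d\<^sup>2"
        using norm_cauchy_schwarz[of "y (F \<xi>) s - y (G k \<xi>) s" "(X (\<xi> k) - A) *v x s"]
        by (simp add: power2_eq_square mult_ac)
    qed
    also have "\<dots> = 2 * h * C\<^sup>2 * V"
      unfolding expect_cmult expect_coordinate[OF k p(2), of "\<lambda>w. (\<delta> w)\<^sup>2"] V_def ..
    finally show ?thesis .
  qed

  let ?e = "\<lambda>\<xi> s. (y (F \<xi>) s - x s) \<bullet> ((F \<xi> s - A) *v x s)"
  have int: "integrable (lebesgue_on {0..t}) (?e \<xi>)" if "\<xi> \<in> outcomes M K" for \<xi>
    unfolding x_def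
    using primitive_on_state_diff(2)[OF F[OF that] A T u, of x0] t xcont[OF F[OF that]] xcont[OF A]
    by (intro integrable_initial[OF integrable_inner_continuous, of T] continuous_intros) (auto simp: y_def)
  have "expect M K p (\<lambda>\<xi>. (norm (y (F \<xi>) t - x t))\<^sup>2)
      \<le> expect M K p (\<lambda>\<xi>. 2 * (LINT s|lebesgue_on {0..t}. ?e \<xi> s))"
  proof (rule expect_mono[OF p(1)])
    fix \<xi> assume \<xi>: "\<xi> \<in> outcomes M K"
    show "(norm (y (F \<xi>) t - x t))\<^sup>2 \<le> 2 * (LINT s|lebesgue_on {0..t}. ?e \<xi> s)"
      using dissipative_energy[OF _ primitive_on_state_diff[OF F[OF \<xi>] A T u, of x0] t] F[OF \<xi>]
        state_primitive(2)[OF F[OF \<xi>] T u, of x0] state_primitive(2)[OF A T u, of x0]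
      by (auto simp: x_def y_def admissible_def)
  qed
  also have "\<dots> = 2 * (LINT s|lebesgue_on {0..t}. expect M K p (\<lambda>\<xi>. ?e \<xi> s))"
    using expect_integral(1)[of M K "lebesgue_on {0..t}" ?e p, OF int] by (simp add: expect_cmult)
  also have "(LINT s|lebesgue_on {0..t}. expect M K p (\<lambda>\<xi>. ?e \<xi> s)) \<le> (LINT s|lebesgue_on {0..T}. 2 * h * C\<^sup>2 * V)"
  proof (rule integral_mono_lebesgue_on_AE)
    have "AE s in lebesgue_on {0..t}. \<exists>k\<in>{1..K}. s \<in> I k"
      using cover t by (simp add: AE_restrict_space_iff) (auto elim: eventually_mono)
    then show "AE s in lebesgue_on {0..t}. expect M K p (\<lambda>\<xi>. ?e \<xi> s) \<le> 2 * h * C\<^sup>2 * V"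
      by (rule eventually_mono) (use pairing in blast)
  qed (use t h V0 in \<open>auto simp: finite_measure.integrable_const finite_measure_lebesgue_on\<close>)
  also have "(LINT s|lebesgue_on {0..T}. 2 * h * C\<^sup>2 * V) = T * (2 * h * C\<^sup>2 * V)"
    using T by (simp add: measure_restrict_space)
  finally show ?thesis
    by (simp add: x_def y_def F_def V_def mult_ac)
qed

section \<open>The adjoint equation\<close>

lemma reflect_integral:
  fixes q :: "real \<Rightarrow> 'a::euclidean_space"
  assumes q: "integrable (lebesgue_on {0..T}) q"
  shows "integrable (lebesgue_on {0..T}) (\<lambda>s. q (T - s))"
    and "t \<in> {0..T} \<Longrightarrow> (LINT s|lebesgue_on {0..t}. q (T - s)) =
      (LINT s|lebesgue_on {0..T}. q s) - (LINT s|lebesgue_on {0..T - t}. q s)"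
proof -
  have "integrable lebesgue (\<lambda>s. indicat_real {0..T} s *\<^sub>R q s)"
    using q by (simp add: integrable_restrict_space)
  then have "integrable lebesgue (\<lambda>s. indicat_real {0..T} (T + (- 1) * s) *\<^sub>R q (T + (- 1) * s))"
    using lebesgue_integrable_real_affine_iff[of "- 1" "\<lambda>s. indicat_real {0..T} s *\<^sub>R q s" T] by simp
  moreover have "indicat_real {0..T} (T + (- 1) * s) = indicat_real {0..T} s" for s
    by (auto simp: indicator_def)
  ultimately show "integrable (lebesgue_on {0..T}) (\<lambda>s. q (T - s))"
    by (simp add: integrable_restrict_space)
  assume t: "t \<in> {0..T}"
  have shift: "indicat_real {T - t..T} (T + (- 1) * s) = indicat_real {0..t} s" for s
    by (auto simp: indicator_def)
  have "(LINT s|lebesgue_on {T - t..T}. q s) = (LINT s|lebesgue. indicat_real {T - t..T} s *\<^sub>R q s)"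
    by (simp add: integral_restrict_space)
  also have "\<dots> = (LINT s|lebesgue. indicat_real {0..t} s *\<^sub>R q (T - s))"
    by (subst lebesgue_integral_real_affine[of "- 1" _ T]) (simp_all add: shift[simplified])
  also have "\<dots> = (LINT s|lebesgue_on {0..t}. q (T - s))"
    by (simp add: integral_restrict_space)
  finally have "(LINT s|lebesgue_on {0..t}. q (T - s)) = (LINT s|lebesgue_on {T - t..T}. q s)" ..
  moreover have "(LINT s|lebesgue_on {0..T - t}. q s) + (LINT s|lebesgue_on {T - t..T}. q s) = (LINT s|lebesgue_on {0..T}. q s)"
  proof -
    have "integrable (lebesgue_on {0..T - t}) q" "integrable (lebesgue_on {T - t..T}) q"
      using t by (auto intro!: integrable_subinterval[OF q])
    then show ?thesis
      using t integrable_on_lebesgue_on[OF q]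
      by (simp add: lebesgue_integral_eq_integral q Henstock_Kurzweil_Integration.integral_combine)
  qed
  ultimately show "(LINT s|lebesgue_on {0..t}. q (T - s)) =
      (LINT s|lebesgue_on {0..T}. q s) - (LINT s|lebesgue_on {0..T - t}. q s)"
    by (metis add_diff_cancel_left')
qed

lemma primitive_on_reflect:
  assumes x: "primitive_on T f x" and T: "0 \<le> T"
  shows "primitive_on T (\<lambda>s. - f (T - s)) (\<lambda>s. x (T - s))"
proof (rule primitive_onI)
  show "integrable (lebesgue_on {0..T}) (\<lambda>s. - f (T - s))"
    using reflect_integral(1)[OF primitive_onD(1)[OF x]] by simp
  fix t assume t: "t \<in> {0..T}"
  have "x T - x 0 = (LINT s|lebesgue_on {0..T}. f s)" "x (T - t) - x 0 = (LINT s|lebesgue_on {0..T - t}. f s)"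
    using t T by (auto intro!: primitive_onD(2)[OF x])
  then have "(LINT s|lebesgue_on {0..t}. f (T - s)) = (x T - x 0) - (x (T - t) - x 0)"
    using reflect_integral(2)[OF primitive_onD(1)[OF x] t] by simp
  then show "x (T - t) - x (T - 0) = (LINT s|lebesgue_on {0..t}. - f (T - s))"
    by simp
qed

lemma inner_transpose: "x \<bullet> (transpose A *v y) = (A *v x) \<bullet> y" for A :: "real^'n^'m"
  by (metis dot_lmul_matrix inner_commute transpose_matrix_vector)

lemma dissipative_transpose:
  assumes "dissipative A" shows "dissipative (transpose A)"
  using assms unfolding dissipative_def inner_transpose by (simp add: inner_commute)

lemma norm_transpose_le:
  fixes A :: "real^'n^'m"
  assumes A: "\<And>v. norm (A *v v) \<le> c * norm v"
  shows "norm (transpose A *v y) \<le> c * norm y"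
proof -
  let ?z = "transpose A *v y"
  have "norm ?z * norm ?z = (A *v ?z) \<bullet> y"
    by (simp only: inner_transpose[symmetric] power2_norm_eq_inner[symmetric] power2_eq_square)
  also have "\<dots> \<le> norm (A *v ?z) * norm y"
    by (rule norm_cauchy_schwarz)
  also have "\<dots> \<le> (c * norm ?z) * norm y"
    by (intro mult_right_mono A) simp
  finally have *: "norm ?z * norm ?z \<le> norm ?z * (c * norm y)"
    by (simp only: mult_ac)
  show ?thesis
  proof (cases "?z = 0")
    case True
    have "0 \<le> c * norm (axis undefined 1 :: real^'n)"
      using A[of "axis undefined 1"] norm_ge_zero order.trans by blast
    then have "0 \<le> c * norm y" unfolding norm_axis_1 by simp
    with True show ?thesis by (simp only: norm_zero)
  next
    case False
    then have "0 < norm ?z" by (simp only: zero_less_norm_iff not_False_eq_True)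
    with * show ?thesis by (simp only: mult_le_cancel_left_pos)
  qed
qed

lemma linear_transpose: "linear (transpose :: real^'n^'m \<Rightarrow> real^'m^'n)"
  by (rule linearI) (simp_all add: transpose_def vec_eq_iff)

lemma admissible_transpose_reflect:
  assumes "admissible F"
  shows "admissible (\<lambda>s. transpose (F (T - s)))"
proof -
  obtain L where L: "\<And>t v. norm (F t *v v) \<le> L * norm v"
    using assms by (auto simp: admissible_def)
  have "(\<lambda>s. T + (- 1) * s :: real) \<in> lebesgue \<rightarrow>\<^sub>M lebesgue"
    using lebesgue_affine_measurable[where c="\<lambda>_::real. - 1" and t=T] by simp
  then have "(\<lambda>s. F (T + (- 1) * s)) \<in> borel_measurable lebesgue"
    by (rule measurable_compose) (use assms in \<open>simp add: admissible_def\<close>)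
  then have "(\<lambda>s. transpose (F (T + (- 1) * s))) \<in> borel_measurable lebesgue"
    by (rule measurable_compose)
       (intro borel_measurable_continuous_onI linear_continuous_on linear_conv_bounded_linear[THEN iffD1] linear_transpose)
  then show ?thesis
    using assms norm_transpose_le[OF L] unfolding admissible_def
    by (simp add: dissipative_transpose del: transpose_matrix_vector) blast
qed

text \<open>The backward adjoint equation \<open>- \<chi>' = F\<^sup>T \<chi> + g\<close>, \<open>\<chi>(T) = 0\<close>, solved as a forward
  equation in reversed time, so that everything proved for states applies to it.\<close>

definition adjoint_state ::
  "(real \<Rightarrow> real^'n^'n) \<Rightarrow> real \<Rightarrow> (real \<Rightarrow> real^'n) \<Rightarrow> real \<Rightarrow> real^'n" where
  "adjoint_state F T g t = state (\<lambda>s. transpose (F (T - s))) (mat 1) 0 T (\<lambda>s. g (T - s)) (T - t)"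

lemma adjoint_state_primitive:
  assumes F: "admissible F" and T: "0 \<le> T" and g: "integrable (lebesgue_on {0..T}) g"
  shows "primitive_on T (\<lambda>s. - (transpose (F s) *v adjoint_state F T g s + g s)) (adjoint_state F T g)"
    and "adjoint_state F T g T = 0"
proof -
  let ?F = "\<lambda>s. transpose (F (T - s))"
  let ?x = "state ?F (mat 1) 0 T (\<lambda>s. g (T - s))"
  have F': "admissible ?F" by (rule admissible_transpose_reflect[OF F])
  have g': "integrable (lebesgue_on {0..T}) (\<lambda>s. mat 1 *v g (T - s))"
    using reflect_integral(1)[OF g] by simp
  have "primitive_on T (\<lambda>s. - (?F (T - s) *v ?x (T - s) + mat 1 *v g (T - (T - s)))) (\<lambda>s. ?x (T - s))"
    using primitive_on_reflect[OF state_primitive(1)[OF F' T g', of 0] T] .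
  then show "primitive_on T (\<lambda>s. - (transpose (F s) *v adjoint_state F T g s + g s)) (adjoint_state F T g)"
    by (rule primitive_on_cong) (simp_all add: adjoint_state_def del: transpose_matrix_vector)
  show "adjoint_state F T g T = 0"
    using state_primitive(2)[OF F' T g', of 0] by (simp add: adjoint_state_def)
qed

lemma adjoint_duality:
  fixes F :: "real \<Rightarrow> real^'n^'n" and B :: "real^'q^'n"
  assumes F: "admissible F" and T: "0 \<le> T" and g: "integrable (lebesgue_on {0..T}) g"
    and v: "integrable (lebesgue_on {0..T}) (\<lambda>s. B *v v s)"
  shows "(LINT s|lebesgue_on {0..T}. g s \<bullet> state F B 0 T v s) =
      (LINT s|lebesgue_on {0..T}. adjoint_state F T g s \<bullet> (B *v v s))"
    and "integrable (lebesgue_on {0..T}) (\<lambda>s. adjoint_state F T g s \<bullet> (B *v v s))"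
    and "integrable (lebesgue_on {0..T}) (\<lambda>s. g s \<bullet> state F B 0 T v s)"
proof -
  let ?y = "state F B 0 T v" and ?x = "adjoint_state F T g"
  note y = state_primitive[OF F T v, of 0] and x = adjoint_state_primitive[OF F T g]
  show i1: "integrable (lebesgue_on {0..T}) (\<lambda>s. ?x s \<bullet> (B *v v s))"
    by (rule integrable_inner_continuous[OF primitive_on_continuous[OF x(1)] v])
  show i2: "integrable (lebesgue_on {0..T}) (\<lambda>s. g s \<bullet> ?y s)"
    using integrable_inner_continuous[OF primitive_on_continuous[OF y(1)] g] by (simp add: inner_commute)
  have "0 = (LINT s|lebesgue_on {0..T}. - (transpose (F s) *v ?x s + g s) \<bullet> ?y s + ?x s \<bullet> (F s *v ?y s + B *v v s))"
    using primitive_on_inner(1)[OF x(1) y(1) T] unfolding x(2) y(2) by simp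
  also have "\<dots> = (LINT s|lebesgue_on {0..T}. ?x s \<bullet> (B *v v s) - g s \<bullet> ?y s)"
  proof (rule Bochner_Integration.integral_cong[OF refl])
    fix s
    have "(transpose (F s) *v ?x s) \<bullet> ?y s = ?x s \<bullet> (F s *v ?y s)"
      using inner_transpose[of "?y s" "F s" "?x s"] by (simp only: inner_commute)
    then show "- (transpose (F s) *v ?x s + g s) \<bullet> ?y s + ?x s \<bullet> (F s *v ?y s + B *v v s) =
        ?x s \<bullet> (B *v v s) - g s \<bullet> ?y s"
      by (simp add: inner_add_left inner_add_right inner_diff_left del: transpose_matrix_vector)
  qed
  also have "\<dots> = (LINT s|lebesgue_on {0..T}. ?x s \<bullet> (B *v v s)) - (LINT s|lebesgue_on {0..T}. g s \<bullet> ?y s)"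
    by (rule Bochner_Integration.integral_diff[OF i1 i2])
  finally show "(LINT s|lebesgue_on {0..T}. g s \<bullet> ?y s) = (LINT s|lebesgue_on {0..T}. ?x s \<bullet> (B *v v s))"
    by simp
qed

section \<open>Square integrable functions\<close>

lemma finite_measure_interval: "finite_measure (lebesgue_on {0..T::real})"
  by (rule finite_measure_lebesgue_on) auto

lemma integrable_const_interval [simp]: "integrable (lebesgue_on {0..T::real}) (\<lambda>_. c :: real)"
  by (rule finite_measure.integrable_const[OF finite_measure_interval])

lemma integral_const_interval: "0 \<le> T \<Longrightarrow> (LINT s|lebesgue_on {0..T}. c) = T * c" for c :: real
  by (simp add: measure_restrict_space)

lemma L2_on_measurable: "L2_on T f \<Longrightarrow> f \<in> borel_measurable (lebesgue_on {0..T})"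
  by (simp add: L2_on_def)

lemma L2_on_norm_square: "L2_on T f \<Longrightarrow> integrable (lebesgue_on {0..T}) (\<lambda>t. (norm (f t))\<^sup>2)"
  by (simp add: L2_on_def)

lemma L2_on_integrable:
  assumes "L2_on T f"
  shows "integrable (lebesgue_on {0..T}) f"
proof -
  have int: "integrable (lebesgue_on {0..T}) (\<lambda>t. 1 + (norm (f t))\<^sup>2)"
    using L2_on_norm_square[OF assms] by simp
  have "norm (f t) \<le> 1 + (norm (f t))\<^sup>2" for t
    using sum_squares_bound[of 1 "norm (f t)"] norm_ge_zero[of "f t"] unfolding power2_eq_square by linarith
  then show ?thesis
    by (intro Bochner_Integration.integrable_bound[OF int L2_on_measurable[OF assms]] AE_I2) auto
qed

lemma L2_on_add_scaleR:
  assumes "L2_on T f" "L2_on T g"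
  shows "L2_on T (\<lambda>t. f t + c *\<^sub>R g t)"
proof -
  have [measurable]: "f \<in> borel_measurable (lebesgue_on {0..T})" "g \<in> borel_measurable (lebesgue_on {0..T})"
    using assms by (auto simp: L2_on_def)
  have int: "integrable (lebesgue_on {0..T}) (\<lambda>t. 2 * (norm (f t))\<^sup>2 + 2 * c\<^sup>2 * (norm (g t))\<^sup>2)"
    using assms by (auto dest!: L2_on_norm_square)
  have bound: "(norm (f t + c *\<^sub>R g t))\<^sup>2 \<le> 2 * (norm (f t))\<^sup>2 + 2 * c\<^sup>2 * (norm (g t))\<^sup>2" for t
  proof -
    have "(norm (f t + c *\<^sub>R g t))\<^sup>2 \<le> (norm (f t) + \<bar>c\<bar> * norm (g t))\<^sup>2"
      using norm_triangle_ineq[of "f t" "c *\<^sub>R g t"] by (intro power_mono) auto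
    also have "\<dots> \<le> 2 * (norm (f t))\<^sup>2 + 2 * (\<bar>c\<bar> * norm (g t))\<^sup>2"
      using sum_squares_bound[of "norm (f t)" "\<bar>c\<bar> * norm (g t)"] by (simp add: power2_sum)
    finally show ?thesis by (simp add: power_mult_distrib)
  qed
  have "integrable (lebesgue_on {0..T}) (\<lambda>t. (norm (f t + c *\<^sub>R g t))\<^sup>2)"
    by (rule Bochner_Integration.integrable_bound[OF int]) (use bound in \<open>auto intro!: AE_I2\<close>)
  then show ?thesis unfolding L2_on_def by simp
qed

lemma L2_on_continuous:
  fixes f :: "real \<Rightarrow> real^'n"
  assumes "continuous_on {0..T} f"
  shows "L2_on T f"
  unfolding L2_on_def
  by (intro conjI borel_measurable_continuous_interval continuous_imp_integrable_real continuous_intros assms)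

lemma L2_on_bilinear:
  fixes Q :: "real^'n^'m"
  assumes "L2_on T f" "L2_on T g"
  shows "integrable (lebesgue_on {0..T}) (\<lambda>t. f t \<bullet> (Q *v g t))"
proof -
  have [measurable]: "f \<in> borel_measurable (lebesgue_on {0..T})" "g \<in> borel_measurable (lebesgue_on {0..T})"
    using assms by (auto simp: L2_on_def)
  have [measurable]: "(\<lambda>t. Q *v g t) \<in> borel_measurable (lebesgue_on {0..T})"
    by (rule borel_measurable_matrix_vector) auto
  have int: "integrable (lebesgue_on {0..T}) (\<lambda>t. onorm ((*v) Q) * ((norm (f t))\<^sup>2 + (norm (g t))\<^sup>2))"
    using assms by (auto dest!: L2_on_norm_square)
  have bound: "\<bar>f t \<bullet> (Q *v g t)\<bar> \<le> onorm ((*v) Q) * ((norm (f t))\<^sup>2 + (norm (g t))\<^sup>2)" for t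
  proof -
    have "\<bar>f t \<bullet> (Q *v g t)\<bar> \<le> norm (f t) * norm (Q *v g t)"
      by (rule Cauchy_Schwarz_ineq2)
    also have "\<dots> \<le> norm (f t) * (onorm ((*v) Q) * norm (g t))"
      by (intro mult_left_mono norm_matrix_vector_le) simp
    also have "\<dots> = onorm ((*v) Q) * (norm (f t) * norm (g t))" by simp
    also have "norm (f t) * norm (g t) \<le> (norm (f t))\<^sup>2 + (norm (g t))\<^sup>2"
      using sum_squares_bound[of "norm (f t)" "norm (g t)"] by (auto intro: order.trans[rotated])
    finally show ?thesis by (simp add: onorm_matrix_nonneg mult_left_mono)
  qed
  show ?thesis
    by (rule Bochner_Integration.integrable_bound[OF int])
       (use bound in \<open>auto intro!: AE_I2 order.trans[OF bound]\<close>)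
qed

lemma integral_square_le:
  fixes f :: "real \<Rightarrow> real"
  assumes f: "integrable (lebesgue_on {0..T}) f" "integrable (lebesgue_on {0..T}) (\<lambda>t. (f t)\<^sup>2)" and T: "0 < T"
  shows "(LINT t|lebesgue_on {0..T}. f t)\<^sup>2 \<le> T * (LINT t|lebesgue_on {0..T}. (f t)\<^sup>2)"
proof -
  define m where "m = (LINT t|lebesgue_on {0..T}. f t)"
  define S where "S = (LINT t|lebesgue_on {0..T}. (f t)\<^sup>2)"
  have "0 \<le> (LINT t|lebesgue_on {0..T}. (T * f t - m)\<^sup>2)"
    by (rule integral_nonneg_AE) simp
  also have "\<dots> = (LINT t|lebesgue_on {0..T}. T\<^sup>2 * (f t)\<^sup>2 - 2 * T * m * f t + m\<^sup>2)"
    by (intro Bochner_Integration.integral_cong) (auto simp: power2_eq_square algebra_simps)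
  also have "\<dots> = T\<^sup>2 * S - 2 * T * m * m + T * m\<^sup>2"
    using f T integral_const_interval[of T "m\<^sup>2"] by (simp add: m_def[symmetric] S_def[symmetric])
  also have "\<dots> = T * (T * S - m\<^sup>2)"
    by (simp add: power2_eq_square algebra_simps)
  finally show ?thesis
    using T by (simp add: zero_le_mult_iff m_def S_def)
qed

section \<open>Minimizers of the quadratic cost\<close>

lemma sym_pos_def_coercive:
  fixes R :: "real^'n^'n"
  assumes "sym_pos_def R"
  obtains \<alpha> where "\<alpha> > 0" "\<And>x. \<alpha> * (norm x)\<^sup>2 \<le> x \<bullet> (R *v x)"
proof -
  have "continuous_on (sphere 0 1) (\<lambda>x. x \<bullet> (R *v x))"
    by (intro continuous_intros linear_continuous_on matrix_vector_mul_bounded_linear)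
  moreover have "axis undefined 1 \<in> sphere (0::real^'n) 1"
    by simp
  ultimately obtain z where z: "z \<in> sphere 0 1" "\<And>x. x \<in> sphere 0 1 \<Longrightarrow> z \<bullet> (R *v z) \<le> x \<bullet> (R *v x)"
    using continuous_attains_inf[of "sphere 0 1" "\<lambda>x. x \<bullet> (R *v x)"] compact_sphere by blast
  have "z \<bullet> (R *v z) * (norm x)\<^sup>2 \<le> x \<bullet> (R *v x)" for x
  proof (cases "x = 0")
    case False
    define e where "e = x /\<^sub>R norm x"
    have "e \<in> sphere 0 1" "norm x *\<^sub>R e = x" using False by (auto simp: e_def)
    have "(norm x *\<^sub>R e) \<bullet> (R *v (norm x *\<^sub>R e)) = (norm x)\<^sup>2 * (e \<bullet> (R *v e))"
      by (simp add: matrix_vector_mult_scaleR power2_eq_square)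
    then have "x \<bullet> (R *v x) = (norm x)\<^sup>2 * (e \<bullet> (R *v e))"
      by (simp only: \<open>norm x *\<^sub>R e = x\<close>)
    then show ?thesis
      using mult_left_mono[OF z(2)[OF \<open>e \<in> sphere 0 1\<close>], of "(norm x)\<^sup>2"] by (simp add: mult.commute)
  qed simp
  moreover have "z \<bullet> (R *v z) > 0"
    using assms z(1) unfolding sym_pos_def_def by (cases "z = 0") auto
  ultimately show thesis using that by blast
qed

lemma quadratic_form_bound: "\<bar>x \<bullet> (Q *v y)\<bar> \<le> onorm ((*v) Q) * (norm x * norm y)" for Q :: "real^'n^'m"
proof -
  have "\<bar>x \<bullet> (Q *v y)\<bar> \<le> norm x * norm (Q *v y)" by (rule Cauchy_Schwarz_ineq2)
  also have "\<dots> \<le> norm x * (onorm ((*v) Q) * norm y)"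
    by (intro mult_left_mono norm_matrix_vector_le) simp
  finally show ?thesis by (simp add: mult_ac)
qed

lemma integral_quadratic_expansion:
  fixes Q :: "real^'n^'n"
  assumes a: "L2_on T a" and b: "L2_on T b" and Q: "transpose Q = Q"
  shows "(LINT t|lebesgue_on {0..T}. (a t + c *\<^sub>R b t) \<bullet> (Q *v (a t + c *\<^sub>R b t))) =
    (LINT t|lebesgue_on {0..T}. a t \<bullet> (Q *v a t)) + 2 * c * (LINT t|lebesgue_on {0..T}. a t \<bullet> (Q *v b t))
      + c\<^sup>2 * (LINT t|lebesgue_on {0..T}. b t \<bullet> (Q *v b t))"
proof -
  have sym: "b t \<bullet> (Q *v a t) = a t \<bullet> (Q *v b t)" for t
    using inner_transpose[of "b t" Q "a t"] Q by (metis inner_commute)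
  have "(LINT t|lebesgue_on {0..T}. (a t + c *\<^sub>R b t) \<bullet> (Q *v (a t + c *\<^sub>R b t))) =
    (LINT t|lebesgue_on {0..T}. a t \<bullet> (Q *v a t) + 2 * c * (a t \<bullet> (Q *v b t)) + c\<^sup>2 * (b t \<bullet> (Q *v b t)))"
    by (intro Bochner_Integration.integral_cong refl)
       (simp add: matrix_vector_right_distrib matrix_vector_mult_scaleR inner_add_left inner_add_right
         sym power2_eq_square algebra_simps)
  then show ?thesis
    using L2_on_bilinear[OF a a, of Q] L2_on_bilinear[OF a b, of Q] L2_on_bilinear[OF b b, of Q] by simp
qed

lemma L2_on_source: "L2_on T u \<Longrightarrow> integrable (lebesgue_on {0..T}) (\<lambda>s. B *v u s)"
  by (intro integrable_matrix_vector L2_on_integrable)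

lemma L2_on_state:
  assumes "admissible F" "0 \<le> T" "L2_on T u"
  shows "L2_on T (state F B x0 T u)"
  by (intro L2_on_continuous primitive_on_continuous[OF state_primitive(1)] assms L2_on_source)

lemma L2_on_diff: "L2_on T f \<Longrightarrow> L2_on T g \<Longrightarrow> L2_on T (\<lambda>t. f t - g t)"
  using L2_on_add_scaleR[of T f g "- 1"] by simp

lemma cost_eq:
  assumes F: "admissible F" and T: "0 \<le> T" and L2: "L2_on T xd" "L2_on T u"
  shows "cost F B x0 Q R xd T u = 1/2 *
    ((LINT t|lebesgue_on {0..T}. (state F B x0 T u t - xd t) \<bullet> (Q *v (state F B x0 T u t - xd t)))
     + (LINT t|lebesgue_on {0..T}. u t \<bullet> (R *v u t)))"
proof -
  have "L2_on T (\<lambda>t. state F B x0 T u t - xd t)"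
    by (intro L2_on_diff L2_on_state F T L2)
  then show ?thesis
    unfolding cost_def using L2_on_bilinear[of T _ _ Q] L2_on_bilinear[OF L2(2) L2(2), of R] by simp
qed

lemma cost_add_scaleR:
  assumes F: "admissible F" and T: "0 \<le> T" and L2: "L2_on T xd" "L2_on T u" "L2_on T v"
    and sym: "transpose Q = Q" "transpose R = R"
  shows "cost F B x0 Q R xd T (\<lambda>s. u s + c *\<^sub>R v s) = cost F B x0 Q R xd T u
    + c * ((LINT t|lebesgue_on {0..T}. (state F B x0 T u t - xd t) \<bullet> (Q *v state F B 0 T v t))
         + (LINT t|lebesgue_on {0..T}. u t \<bullet> (R *v v t)))
    + c\<^sup>2 * (1/2 * ((LINT t|lebesgue_on {0..T}. state F B 0 T v t \<bullet> (Q *v state F B 0 T v t))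
         + (LINT t|lebesgue_on {0..T}. v t \<bullet> (R *v v t))))"
proof -
  let ?a = "\<lambda>t. state F B x0 T u t - xd t" and ?b = "state F B 0 T v"
  have a: "L2_on T ?a" and b: "L2_on T ?b"
    by (intro L2_on_diff L2_on_state F T L2)+
  have eq: "state F B x0 T (\<lambda>s. u s + c *\<^sub>R v s) t - xd t = ?a t + c *\<^sub>R ?b t" if "t \<in> {0..T}" for t
    using state_add_scaleR[OF F T that L2_on_source[OF L2(2)] L2_on_source[OF L2(3)], of B x0 c] by simp
  have "(LINT t|lebesgue_on {0..T}. (state F B x0 T (\<lambda>s. u s + c *\<^sub>R v s) t - xd t) \<bullet>
        (Q *v (state F B x0 T (\<lambda>s. u s + c *\<^sub>R v s) t - xd t))) =
      (LINT t|lebesgue_on {0..T}. (?a t + c *\<^sub>R ?b t) \<bullet> (Q *v (?a t + c *\<^sub>R ?b t)))"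
    by (rule Bochner_Integration.integral_cong[OF refl]) (simp only: space_lebesgue_on eq)
  then show ?thesis
    unfolding cost_eq[OF F T L2(1) L2_on_add_scaleR[OF L2(2,3)]] cost_eq[OF F T L2(1,2)]
      integral_quadratic_expansion[OF a b sym(1)] integral_quadratic_expansion[OF L2(2,3) sym(2)]
    by (simp add: algebra_simps)
qed

lemma linear_term_zero:
  fixes a b :: real
  assumes "\<And>c. 0 \<le> c * a + c\<^sup>2 * b"
  shows "a = 0"
proof (rule ccontr)
  assume "a \<noteq> 0"
  define k where "k = \<bar>b\<bar> + 1"
  have k: "k > 0" "b \<le> k" by (auto simp: k_def)
  have "0 \<le> (- a / (2 * k)) * a + (- a / (2 * k))\<^sup>2 * b" by (rule assms)
  also have "\<dots> \<le> (- a / (2 * k)) * a + (- a / (2 * k))\<^sup>2 * k"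
    using k by (intro add_left_mono mult_left_mono) auto
  also have "\<dots> = - (a\<^sup>2 / (4 * k))"
    using k by (simp add: field_simps power2_eq_square)
  finally have "a\<^sup>2 / (4 * k) \<le> 0" by simp
  moreover have "a\<^sup>2 / (4 * k) > 0" using k \<open>a \<noteq> 0\<close> by simp
  ultimately show False by simp
qed

lemma first_order_condition:
  assumes F: "admissible F" and T: "0 \<le> T" and L2: "L2_on T xd" "L2_on T v"
    and sym: "transpose Q = Q" "transpose R = R"
    and min: "is_arg_min (cost F B x0 Q R xd T) (L2_on T) u"
  shows "(LINT t|lebesgue_on {0..T}. (state F B x0 T u t - xd t) \<bullet> (Q *v state F B 0 T v t))
         + (LINT t|lebesgue_on {0..T}. u t \<bullet> (R *v v t)) = 0"
proof (rule linear_term_zero)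
  fix c :: real
  have u: "L2_on T u" using min by (simp add: is_arg_min_def)
  have "cost F B x0 Q R xd T u \<le> cost F B x0 Q R xd T (\<lambda>s. u s + c *\<^sub>R v s)"
    using min L2_on_add_scaleR[OF u L2(2), of c] unfolding is_arg_min_def by (meson linorder_not_less)
  then show "0 \<le> c * ((LINT t|lebesgue_on {0..T}. (state F B x0 T u t - xd t) \<bullet> (Q *v state F B 0 T v t))
         + (LINT t|lebesgue_on {0..T}. u t \<bullet> (R *v v t)))
    + c\<^sup>2 * (1/2 * ((LINT t|lebesgue_on {0..T}. state F B 0 T v t \<bullet> (Q *v state F B 0 T v t))
         + (LINT t|lebesgue_on {0..T}. v t \<bullet> (R *v v t))))"
    unfolding cost_add_scaleR[OF F T L2(1) u L2(2) sym] by linarith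
qed

lemma young_inequality:
  fixes a b \<alpha> :: real
  assumes "\<alpha> > 0"
  shows "a * b \<le> \<alpha> / 4 * b\<^sup>2 + a\<^sup>2 / \<alpha>"
proof -
  have "0 \<le> (\<alpha> * b / 2 - a)\<^sup>2 / \<alpha>" using assms by simp
  also have "\<dots> = \<alpha> / 4 * b\<^sup>2 + a\<^sup>2 / \<alpha> - a * b"
    using assms by (simp add: field_simps power2_eq_square)
  finally show ?thesis by simp
qed

text \<open>Put \<open>v = w - u\<close>. Both first order conditions are tested with \<open>v\<close> and subtracted. By
  coercivity the remaining quadratic part controls the integral of \<open>(norm v)\<^sup>2\<close>, and the rest is a sum
  of two defects at the control \<open>u\<close>: the difference of its two states, and the difference of the
  two responses to \<open>v\<close> tested against \<open>g = Q (x - x\<^sub>d)\<close>. For a random coefficient \<open>F\<close> the response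
  to \<open>v\<close> is out of reach of the mean square estimate, since \<open>v\<close> is random and depends on the whole
  of \<open>F\<close>. Duality replaces it by the difference of two adjoint states, whose source \<open>g\<close> does not
  depend on \<open>F\<close>.

  The increment of the cost of \<open>G\<close> from its minimizer \<open>u\<close> to \<open>w\<close> is purely quadratic in \<open>v\<close>, which
  is why the two errors enter squared.\<close>

lemma minimizer_cost_difference:
  fixes A :: "real^'n^'n" and B :: "real^'q^'n"
  assumes A: "admissible G" and F: "admissible F" and T: "0 < T" and xd: "L2_on T xd"
    and sym: "transpose Q = Q" "transpose R = R" and Q0: "\<And>x. 0 \<le> x \<bullet> (Q *v x)"
    and \<alpha>: "\<alpha> > 0" "\<And>x. \<alpha> * (norm x)\<^sup>2 \<le> x \<bullet> (R *v x)"
    and u: "is_arg_min (cost G B x0 Q R xd T) (L2_on T) u"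
    and w: "is_arg_min (cost F B x0 Q R xd T) (L2_on T) w"
  defines "q \<equiv> onorm ((*v) Q)" and "b \<equiv> onorm ((*v) B)" and "r \<equiv> onorm ((*v) R)"
    and "g \<equiv> \<lambda>s. Q *v (state G B x0 T u s - xd s)"
  shows "\<bar>cost G B x0 Q R xd T w - cost G B x0 Q R xd T u\<bar> \<le>
     (4 * q * b\<^sup>2 * T\<^sup>2 + r) / \<alpha>\<^sup>2 * (4 * q\<^sup>2 * b\<^sup>2 * T\<^sup>2 + b\<^sup>2) *
     ((LINT t|lebesgue_on {0..T}. (norm (state F B x0 T u t - state G B x0 T u t))\<^sup>2)
      + (LINT t|lebesgue_on {0..T}. (norm (adjoint_state F T g t - adjoint_state G T g t))\<^sup>2))"
proof -
  have T0: "0 \<le> T" using T by simp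
  have uL2: "L2_on T u" and wL2: "L2_on T w" using u w by (simp_all add: is_arg_min_def)
  define v where "v s = w s - u s" for s
  have vL2: "L2_on T v" unfolding v_def by (intro L2_on_diff uL2 wL2)
  have w_eq: "w = (\<lambda>s. u s + 1 *\<^sub>R v s)" by (simp add: v_def)
  define x xF y yF where "x = state G B x0 T u" and "xF = state F B x0 T u"
    and "y = state G B 0 T v" and "yF = state F B 0 T v"
  have L2s: "L2_on T x" "L2_on T xF" "L2_on T y" "L2_on T yF"
    unfolding x_def xF_def y_def yF_def by (intro L2_on_state A F T0 uL2 vL2)+
  define e \<eta> where "e s = xF s - x s" and "\<eta> s = adjoint_state F T g s - adjoint_state G T g s" for s
  have e: "L2_on T e" unfolding e_def by (intro L2_on_diff L2s)
  have xxd: "L2_on T (\<lambda>s. x s - xd s)" and xFxd: "L2_on T (\<lambda>s. xF s - xd s)"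
    by (intro L2_on_diff L2s xd)+
  have gint: "integrable (lebesgue_on {0..T}) g"
    using L2_on_source[OF xxd, of Q] unfolding g_def x_def .
  have \<eta>: "L2_on T \<eta>"
    unfolding \<eta>_def by (intro L2_on_diff L2_on_continuous primitive_on_continuous[OF adjoint_state_primitive(1)] A F T0 gint)
  note q0 = onorm_matrix_nonneg[of Q, folded q_def] and b0 = onorm_matrix_nonneg[of B, folded b_def]
    and r0 = onorm_matrix_nonneg[of R, folded r_def]
  define N E E2 H2 m where "N = (LINT t|lebesgue_on {0..T}. (norm (v t))\<^sup>2)"
    and "E = (LINT t|lebesgue_on {0..T}. norm (e t))"
    and "E2 = (LINT t|lebesgue_on {0..T}. (norm (e t))\<^sup>2)"
    and "H2 = (LINT t|lebesgue_on {0..T}. (norm (\<eta> t))\<^sup>2)"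
    and "m = (LINT t|lebesgue_on {0..T}. norm (v t))"
  have nonneg: "0 \<le> N" "0 \<le> E" "0 \<le> E2" "0 \<le> H2" "0 \<le> m"
    unfolding N_def E_def E2_def H2_def m_def by (auto intro!: integral_nonneg_AE)
  have E: "E\<^sup>2 \<le> T * E2"
    unfolding E_def E2_def using L2_on_integrable[OF e] L2_on_norm_square[OF e] T
    by (intro integral_square_le) auto
  have m: "m\<^sup>2 \<le> T * N"
    unfolding m_def N_def using L2_on_integrable[OF vL2] L2_on_norm_square[OF vL2] T
    by (intro integral_square_le) auto
  have ybound: "norm (state H B 0 T v t) \<le> 2 * b * m" if "admissible H" "t \<in> {0..T}" for H t
  proof -
    have "norm (state H B 0 T v t) \<le> 2 * (LINT s|lebesgue_on {0..T}. norm (B *v v s))"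
      using state_bound[OF that L2_on_source[OF vL2], of B 0] by simp
    also have "(LINT s|lebesgue_on {0..T}. norm (B *v v s)) \<le> (LINT s|lebesgue_on {0..T}. b * norm (v s))"
      using L2_on_source[OF vL2, of B] L2_on_integrable[OF vL2] norm_matrix_vector_le[of B]
      by (intro integral_mono) (auto simp: b_def)
    finally show ?thesis by (simp add: m_def mult.assoc)
  qed

  note Qint = L2_on_bilinear[where Q = Q] and Rint = L2_on_bilinear[where Q = R]
  have opt_u: "(LINT t|lebesgue_on {0..T}. (x t - xd t) \<bullet> (Q *v y t)) + (LINT t|lebesgue_on {0..T}. u t \<bullet> (R *v v t)) = 0"
    unfolding x_def y_def by (rule first_order_condition[OF A T0 xd vL2 sym u])
  have "(LINT t|lebesgue_on {0..T}. (state F B x0 T w t - xd t) \<bullet> (Q *v yF t)) + (LINT t|lebesgue_on {0..T}. w t \<bullet> (R *v v t)) = 0"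
    unfolding yF_def by (rule first_order_condition[OF F T0 xd vL2 sym w])
  moreover have "(LINT t|lebesgue_on {0..T}. (state F B x0 T w t - xd t) \<bullet> (Q *v yF t)) =
      (LINT t|lebesgue_on {0..T}. (xF t - xd t) \<bullet> (Q *v yF t)) + (LINT t|lebesgue_on {0..T}. yF t \<bullet> (Q *v yF t))"
  proof -
    have eq: "state F B x0 T w t = xF t + yF t" if "t \<in> {0..T}" for t
      using state_add_scaleR[OF F T0 that L2_on_source[OF uL2] L2_on_source[OF vL2], of B x0 1]
      unfolding w_eq xF_def yF_def by simp
    have "(LINT t|lebesgue_on {0..T}. (state F B x0 T w t - xd t) \<bullet> (Q *v yF t)) =
        (LINT t|lebesgue_on {0..T}. (xF t - xd t) \<bullet> (Q *v yF t) + yF t \<bullet> (Q *v yF t))"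
      by (rule Bochner_Integration.integral_cong[OF refl])
         (simp add: eq inner_add_left inner_diff_left)
    then show ?thesis
      using Qint[OF xFxd L2s(4)] Qint[OF L2s(4) L2s(4)] by simp
  qed
  moreover have "(LINT t|lebesgue_on {0..T}. w t \<bullet> (R *v v t)) =
      (LINT t|lebesgue_on {0..T}. u t \<bullet> (R *v v t)) + (LINT t|lebesgue_on {0..T}. v t \<bullet> (R *v v t))"
    unfolding w_eq using Rint[OF uL2 vL2] Rint[OF vL2 vL2] by (simp add: inner_add_left)
  ultimately have quad: "(LINT t|lebesgue_on {0..T}. yF t \<bullet> (Q *v yF t)) + (LINT t|lebesgue_on {0..T}. v t \<bullet> (R *v v t))
      = (LINT t|lebesgue_on {0..T}. (x t - xd t) \<bullet> (Q *v y t)) - (LINT t|lebesgue_on {0..T}. (xF t - xd t) \<bullet> (Q *v yF t))"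
    using opt_u by linarith
  have g_eq: "(LINT t|lebesgue_on {0..T}. (x t - xd t) \<bullet> (Q *v z t)) = (LINT t|lebesgue_on {0..T}. g t \<bullet> z t)" for z
    using inner_transpose[of "x t - xd t" Q "z t" for t] unfolding sym g_def x_def by simp
  have "(LINT t|lebesgue_on {0..T}. (x t - xd t) \<bullet> (Q *v y t)) =
      (LINT t|lebesgue_on {0..T}. adjoint_state G T g t \<bullet> (B *v v t))"
    unfolding g_eq y_def by (rule adjoint_duality(1)[OF A T0 gint L2_on_source[OF vL2]])
  moreover have "(LINT t|lebesgue_on {0..T}. (x t - xd t) \<bullet> (Q *v yF t)) =
      (LINT t|lebesgue_on {0..T}. adjoint_state F T g t \<bullet> (B *v v t))"
    unfolding g_eq yF_def by (rule adjoint_duality(1)[OF F T0 gint L2_on_source[OF vL2]])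
  moreover have "(LINT t|lebesgue_on {0..T}. (xF t - xd t) \<bullet> (Q *v yF t)) =
      (LINT t|lebesgue_on {0..T}. (x t - xd t) \<bullet> (Q *v yF t)) + (LINT t|lebesgue_on {0..T}. e t \<bullet> (Q *v yF t))"
    using Qint[OF xxd L2s(4)] Qint[OF e L2s(4)]
    by (subst Bochner_Integration.integral_add[symmetric]) (auto simp: e_def inner_add_left[symmetric])
  ultimately have "(LINT t|lebesgue_on {0..T}. yF t \<bullet> (Q *v yF t)) + (LINT t|lebesgue_on {0..T}. v t \<bullet> (R *v v t))
      = (LINT t|lebesgue_on {0..T}. adjoint_state G T g t \<bullet> (B *v v t))
        - (LINT t|lebesgue_on {0..T}. adjoint_state F T g t \<bullet> (B *v v t))
        - (LINT t|lebesgue_on {0..T}. e t \<bullet> (Q *v yF t))"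
    using quad by linarith
  also have "\<dots> = (LINT t|lebesgue_on {0..T}. - \<eta> t \<bullet> (B *v v t)) + (LINT t|lebesgue_on {0..T}. - e t \<bullet> (Q *v yF t))"
    using adjoint_duality(2)[OF A T0 gint L2_on_source[OF vL2], of B] adjoint_duality(2)[OF F T0 gint L2_on_source[OF vL2], of B]
    by (simp add: \<eta>_def inner_diff_left)
  also have "(LINT t|lebesgue_on {0..T}. - \<eta> t \<bullet> (B *v v t)) \<le>
      (LINT t|lebesgue_on {0..T}. \<alpha> / 4 * (norm (v t))\<^sup>2 + b\<^sup>2 / \<alpha> * (norm (\<eta> t))\<^sup>2)"
  proof (rule integral_mono)
    fix t
    have "- \<eta> t \<bullet> (B *v v t) \<le> b * (norm (\<eta> t) * norm (v t))"
      using quadratic_form_bound[of "\<eta> t" B "v t"] unfolding b_def by simp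
    also have "\<dots> \<le> \<alpha> / 4 * (norm (v t))\<^sup>2 + b\<^sup>2 / \<alpha> * (norm (\<eta> t))\<^sup>2"
      using young_inequality[OF \<alpha>(1), of "b * norm (\<eta> t)" "norm (v t)"] by (simp add: power_mult_distrib mult.assoc)
    finally show "- \<eta> t \<bullet> (B *v v t) \<le> \<alpha> / 4 * (norm (v t))\<^sup>2 + b\<^sup>2 / \<alpha> * (norm (\<eta> t))\<^sup>2" .
  qed (use L2_on_bilinear[OF \<eta> vL2, of B] L2_on_norm_square[OF vL2] L2_on_norm_square[OF \<eta>] in auto)
  also have "(LINT t|lebesgue_on {0..T}. \<alpha> / 4 * (norm (v t))\<^sup>2 + b\<^sup>2 / \<alpha> * (norm (\<eta> t))\<^sup>2)
      = \<alpha> / 4 * N + b\<^sup>2 / \<alpha> * H2"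
    using L2_on_norm_square[OF vL2] L2_on_norm_square[OF \<eta>] by (simp add: N_def H2_def)
  also have "(LINT t|lebesgue_on {0..T}. - e t \<bullet> (Q *v yF t)) \<le> (LINT t|lebesgue_on {0..T}. q * (2 * b * m) * norm (e t))"
  proof (rule integral_mono)
    fix t assume "t \<in> space (lebesgue_on {0..T})"
    then have "norm (yF t) \<le> 2 * b * m" unfolding yF_def using ybound[OF F] by simp
    then have "q * (norm (e t) * norm (yF t)) \<le> q * (norm (e t) * (2 * b * m))"
      using q0 by (intro mult_left_mono) auto
    then show "- e t \<bullet> (Q *v yF t) \<le> q * (2 * b * m) * norm (e t)"
      using quadratic_form_bound[of "e t" Q "yF t"] unfolding q_def by (simp add: mult_ac)
  qed (use L2_on_bilinear[OF e L2s(4), of Q] L2_on_integrable[OF e] in auto)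
  also have "(LINT t|lebesgue_on {0..T}. q * (2 * b * m) * norm (e t)) = (LINT t|lebesgue_on {0..T}. (2 * q * b * E) * norm (v t))"
    by (simp add: E_def m_def mult_ac)
  also have "\<dots> \<le> (LINT t|lebesgue_on {0..T}. \<alpha> / 4 * (norm (v t))\<^sup>2 + (2 * q * b * E)\<^sup>2 / \<alpha>)"
    using young_inequality[OF \<alpha>(1), of "2 * q * b * E"] L2_on_norm_square[OF vL2] L2_on_integrable[OF vL2]
    by (intro integral_mono) auto
  also have "\<dots> = \<alpha> / 4 * N + T * ((2 * q * b * E)\<^sup>2 / \<alpha>)"
    using L2_on_norm_square[OF vL2] integral_const_interval[OF T0] by (simp add: N_def)
  finally have "(LINT t|lebesgue_on {0..T}. yF t \<bullet> (Q *v yF t)) + (LINT t|lebesgue_on {0..T}. v t \<bullet> (R *v v t))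
      \<le> \<alpha> / 4 * N + b\<^sup>2 / \<alpha> * H2 + (\<alpha> / 4 * N + T * ((2 * q * b * E)\<^sup>2 / \<alpha>))"
    by simp
  moreover have "T * ((2 * q * b * E)\<^sup>2 / \<alpha>) \<le> T * (4 * q\<^sup>2 * b\<^sup>2 * (T * E2) / \<alpha>)"
    using mult_left_mono[OF E, of "4 * q\<^sup>2 * b\<^sup>2"] T \<alpha>(1)
    by (intro mult_left_mono divide_right_mono) (auto simp: power_mult_distrib)
  moreover have "\<alpha> / 4 * N + b\<^sup>2 / \<alpha> * H2 + (\<alpha> / 4 * N + T * (4 * q\<^sup>2 * b\<^sup>2 * (T * E2) / \<alpha>))
      = \<alpha> / 2 * N + (4 * q\<^sup>2 * b\<^sup>2 * T\<^sup>2 * E2 + b\<^sup>2 * H2) / \<alpha>"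
    by (simp add: add_divide_distrib power2_eq_square mult_ac)
  ultimately have "(LINT t|lebesgue_on {0..T}. yF t \<bullet> (Q *v yF t)) + (LINT t|lebesgue_on {0..T}. v t \<bullet> (R *v v t))
      \<le> \<alpha> / 2 * N + (4 * q\<^sup>2 * b\<^sup>2 * T\<^sup>2 * E2 + b\<^sup>2 * H2) / \<alpha>"
    by linarith
  moreover have "0 \<le> (LINT t|lebesgue_on {0..T}. yF t \<bullet> (Q *v yF t))"
    using Q0 by (auto intro: integral_nonneg_AE)
  moreover have "\<alpha> * N \<le> (LINT t|lebesgue_on {0..T}. v t \<bullet> (R *v v t))"
  proof -
    have "(LINT t|lebesgue_on {0..T}. \<alpha> * (norm (v t))\<^sup>2) \<le> (LINT t|lebesgue_on {0..T}. v t \<bullet> (R *v v t))"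
      using \<alpha>(2) L2_on_norm_square[OF vL2] Rint[OF vL2 vL2] by (intro integral_mono) auto
    then show ?thesis by (simp add: N_def)
  qed
  \<comment> \<open>The half of \<open>\<alpha> N\<close> that Young's inequality produced is absorbed.\<close>
  ultimately have "\<alpha> / 2 * N \<le> (4 * q\<^sup>2 * b\<^sup>2 * T\<^sup>2 * E2 + b\<^sup>2 * H2) / \<alpha>"
    by (simp add: field_simps)
  also have "\<dots> \<le> (4 * q\<^sup>2 * b\<^sup>2 * T\<^sup>2 + b\<^sup>2) * (E2 + H2) / \<alpha>"
    using nonneg \<alpha>(1) by (intro divide_right_mono) (auto simp: algebra_simps)
  finally have N_le: "N \<le> 2 * ((4 * q\<^sup>2 * b\<^sup>2 * T\<^sup>2 + b\<^sup>2) * (E2 + H2)) / \<alpha>\<^sup>2"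
    using \<alpha>(1) by (simp add: field_simps power2_eq_square)

  have "cost G B x0 Q R xd T u \<le> cost G B x0 Q R xd T w"
    using u wL2 unfolding is_arg_min_def by (meson linorder_not_less)
  moreover have "cost G B x0 Q R xd T w = cost G B x0 Q R xd T u +
      1/2 * ((LINT t|lebesgue_on {0..T}. y t \<bullet> (Q *v y t)) + (LINT t|lebesgue_on {0..T}. v t \<bullet> (R *v v t)))"
    using first_order_condition[OF A T0 xd vL2 sym u] cost_add_scaleR[OF A T0 xd uL2 vL2 sym, of B x0 1]
    unfolding w_eq y_def by simp
  moreover have "(LINT t|lebesgue_on {0..T}. y t \<bullet> (Q *v y t)) \<le> (LINT t|lebesgue_on {0..T}. q * (2 * b * m)\<^sup>2)"
  proof (rule integral_mono)
    fix t assume "t \<in> space (lebesgue_on {0..T})"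
    then have "norm (y t) \<le> 2 * b * m" unfolding y_def using ybound[OF A] by simp
    then have "q * (norm (y t) * norm (y t)) \<le> q * ((2 * b * m) * (2 * b * m))"
      using q0 by (intro mult_left_mono mult_mono) (auto simp: b0 nonneg)
    then show "y t \<bullet> (Q *v y t) \<le> q * (2 * b * m)\<^sup>2"
      using quadratic_form_bound[of "y t" Q "y t"] unfolding q_def power2_eq_square by linarith
  qed (use Qint[OF L2s(3) L2s(3)] in auto)
  moreover have "(LINT t|lebesgue_on {0..T}. q * (2 * b * m)\<^sup>2) \<le> 4 * q * b\<^sup>2 * T\<^sup>2 * N"
    unfolding integral_const_interval[OF T0]
    using mult_left_mono[OF m mult_nonneg_nonneg[OF mult_nonneg_nonneg[OF q0 zero_le_power2[of b]] T0]]
    by (simp add: power_mult_distrib power2_eq_square mult_ac)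
  moreover have "(LINT t|lebesgue_on {0..T}. v t \<bullet> (R *v v t)) \<le> r * N"
  proof -
    have "(LINT t|lebesgue_on {0..T}. v t \<bullet> (R *v v t)) \<le> (LINT t|lebesgue_on {0..T}. r * (norm (v t))\<^sup>2)"
      using Rint[OF vL2 vL2] L2_on_norm_square[OF vL2] quadratic_form_bound[of "v t" R "v t" for t]
      by (intro integral_mono) (auto simp: r_def power2_eq_square abs_le_iff)
    then show ?thesis by (simp add: N_def)
  qed
  ultimately have "\<bar>cost G B x0 Q R xd T w - cost G B x0 Q R xd T u\<bar> \<le> 1/2 * ((4 * q * b\<^sup>2 * T\<^sup>2 + r) * N)"
    by (simp add: algebra_simps)
  also have "\<dots> \<le> 1/2 * ((4 * q * b\<^sup>2 * T\<^sup>2 + r) * (2 * ((4 * q\<^sup>2 * b\<^sup>2 * T\<^sup>2 + b\<^sup>2) * (E2 + H2)) / \<alpha>\<^sup>2))"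
    using N_le q0 r0 by (intro mult_left_mono) auto
  also have "\<dots> = (4 * q * b\<^sup>2 * T\<^sup>2 + r) / \<alpha>\<^sup>2 * (4 * q\<^sup>2 * b\<^sup>2 * T\<^sup>2 + b\<^sup>2) * (E2 + H2)"
    by simp
  finally show ?thesis
    by (simp add: E2_def H2_def e_def \<eta>_def x_def xF_def)
qed

section \<open>The error in expectation\<close>

text \<open>The constant of the theorem must not depend on the optimal control, so its norm is bounded
  by comparing with the zero control.\<close>

lemma minimizer_L1_bound:
  fixes u :: "real \<Rightarrow> real^'q"
  assumes F: "admissible F" and T: "0 < T" and xd: "L2_on T xd"
    and Q0: "\<And>x. 0 \<le> x \<bullet> (Q *v x)" and \<alpha>: "\<alpha> > 0" "\<And>x. \<alpha> * (norm x)\<^sup>2 \<le> x \<bullet> (R *v x)"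
    and u: "is_arg_min (cost F B x0 Q R xd T) (L2_on T) u"
  shows "(LINT s|lebesgue_on {0..T}. norm (u s)) \<le> T + 2 / \<alpha> * cost F B x0 Q R xd T (\<lambda>_. 0)"
proof -
  have T0: "0 \<le> T" using T by simp
  have uL2: "L2_on T u" using u by (simp add: is_arg_min_def)
  have "L2_on T (\<lambda>_. 0 :: real^'q)" by (rule L2_on_continuous) (rule continuous_on_const)
  then have "cost F B x0 Q R xd T u \<le> cost F B x0 Q R xd T (\<lambda>_. 0)"
    using u unfolding is_arg_min_def by (meson linorder_not_less)
  moreover have "0 \<le> (LINT t|lebesgue_on {0..T}. (state F B x0 T u t - xd t) \<bullet> (Q *v (state F B x0 T u t - xd t)))"
    using Q0 by (intro integral_nonneg_AE) auto
  moreover have "(LINT t|lebesgue_on {0..T}. \<alpha> * (norm (u t))\<^sup>2) \<le> (LINT t|lebesgue_on {0..T}. u t \<bullet> (R *v u t))"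
    using \<alpha>(2) L2_on_norm_square[OF uL2] L2_on_bilinear[OF uL2 uL2] by (intro integral_mono) auto
  ultimately have "\<alpha> * (LINT t|lebesgue_on {0..T}. (norm (u t))\<^sup>2) \<le> 2 * cost F B x0 Q R xd T (\<lambda>_. 0)"
    unfolding cost_eq[OF F T0 xd uL2] by simp
  then have "(LINT t|lebesgue_on {0..T}. (norm (u t))\<^sup>2) \<le> 2 / \<alpha> * cost F B x0 Q R xd T (\<lambda>_. 0)"
    using \<alpha>(1) by (simp add: field_simps)
  moreover have "(LINT s|lebesgue_on {0..T}. norm (u s)) \<le> (LINT s|lebesgue_on {0..T}. 1 + (norm (u s))\<^sup>2)"
  proof (rule integral_mono)
    show "norm (u s) \<le> 1 + (norm (u s))\<^sup>2" for s
      using sum_squares_bound[of 1 "norm (u s)"] norm_ge_zero[of "u s"] unfolding power2_eq_square by linarith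
  qed (use L2_on_integrable[OF uL2] L2_on_norm_square[OF uL2] in auto)
  moreover have "(LINT s|lebesgue_on {0..T}. 1 + (norm (u s))\<^sup>2) = T + (LINT s|lebesgue_on {0..T}. (norm (u s))\<^sup>2)"
    using L2_on_norm_square[OF uL2] integral_const_interval[OF T0, of 1] by simp
  ultimately show ?thesis by linarith
qed

lemma expect_integral_le:
  assumes p: "\<forall>w\<in>{1..2^M}. 0 \<le> p w" and T: "0 \<le> T"
    and f: "\<And>\<xi>. \<xi> \<in> outcomes M K \<Longrightarrow> integrable (lebesgue_on {0..T}) (f \<xi>)"
    and le: "\<And>t. t \<in> {0..T} \<Longrightarrow> expect M K p (\<lambda>\<xi>. f \<xi> t) \<le> c"
  shows "expect M K p (\<lambda>\<xi>. LINT t|lebesgue_on {0..T}. f \<xi> t) \<le> T * c"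
proof -
  have "(LINT t|lebesgue_on {0..T}. expect M K p (\<lambda>\<xi>. f \<xi> t)) \<le> (LINT t|lebesgue_on {0..T}. c)"
    using expect_integral(2)[of M K "lebesgue_on {0..T}" f p, OF f] le by (intro integral_mono) auto
  then show ?thesis
    unfolding integral_const_interval[OF T] using expect_integral(1)[of M K "lebesgue_on {0..T}" f p, OF f] by simp
qed

lemma transpose_piecewise:
  "transpose (piecewise I K Y (T - s)) = piecewise (\<lambda>k. {s. T - s \<in> I k}) K (\<lambda>k. transpose (Y k)) s"
  unfolding piecewise_def linear_sum[OF linear_transpose]
  by (intro sum.cong) (auto simp: transpose_scalar indicator_def)

lemma sampled_matrix_dissipative:
  assumes S: "S w \<subseteq> {1..M}" and Am: "\<And>m. m \<in> {1..M} \<Longrightarrow> dissipative (Am m)"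
    and pos: "\<And>m. m \<in> {1..M} \<Longrightarrow> 0 < sel_prob M S p m"
  shows "dissipative (sampled_matrix M S p Am w)"
  unfolding dissipative_def
proof
  fix x
  from linear_sum[OF linear_inner_matrix] have "x \<bullet> (sampled_matrix M S p Am w *v x) =
      (\<Sum>m\<in>S w. x \<bullet> (((1 / sel_prob M S p m) *\<^sub>R Am m) *v x))"
    unfolding sampled_matrix_def .
  also have "\<dots> \<le> 0"
  proof (rule sum_nonpos)
    fix m assume "m \<in> S w"
    then have m: "m \<in> {1..M}" using S by blast
    then have "x \<bullet> (Am m *v x) \<le> 0" using Am by (auto simp: dissipative_def)
    then show "x \<bullet> (((1 / sel_prob M S p m) *\<^sub>R Am m) *v x) \<le> 0"
      using pos[OF m] by (simp add: scaleR_matrix_vector_assoc[symmetric] divide_nonpos_pos)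
  qed
  finally show "x \<bullet> (sampled_matrix M S p Am w *v x) \<le> 0" .
qed

lemma sampled_matrix_mean:
  assumes S: "\<And>w. w \<in> {1..2^M} \<Longrightarrow> S w \<subseteq> {1..M}"
    and pos: "\<And>m. m \<in> {1..M} \<Longrightarrow> 0 < sel_prob M S p m"
  shows "(\<Sum>w=1..2^M. p w *\<^sub>R sampled_matrix M S p Am w) = (\<Sum>m=1..M. Am m)"
proof -
  have "(\<Sum>w=1..2^M. p w *\<^sub>R sampled_matrix M S p Am w) =
      (\<Sum>w=1..2^M. \<Sum>m\<in>{m\<in>{1..M}. m \<in> S w}. (p w / sel_prob M S p m) *\<^sub>R Am m)"
  proof (rule sum.cong[OF refl])
    fix w assume "w \<in> {1..2^M::nat}"
    then have "{m\<in>{1..M}. m \<in> S w} = S w" using S by blast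
    then show "p w *\<^sub>R sampled_matrix M S p Am w = (\<Sum>m\<in>{m\<in>{1..M}. m \<in> S w}. (p w / sel_prob M S p m) *\<^sub>R Am m)"
      by (simp add: sampled_matrix_def scaleR_right.sum)
  qed
  also have "\<dots> = (\<Sum>m=1..M. \<Sum>w\<in>{w\<in>{1..2^M}. m \<in> S w}. (p w / sel_prob M S p m) *\<^sub>R Am m)"
    by (rule sum.swap_restrict) auto
  also have "\<dots> = (\<Sum>m=1..M. Am m)"
  proof (rule sum.cong[OF refl])
    fix m assume "m \<in> {1..M}"
    from pos[OF this] show "(\<Sum>w\<in>{w\<in>{1..2^M}. m \<in> S w}. (p w / sel_prob M S p m) *\<^sub>R Am m) = Am m"
      by (simp add: sel_prob_def flip: scaleR_left.sum sum_divide_distrib)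
  qed
  finally show ?thesis .
qed

lemma grid_mono:
  assumes "is_grid T K \<tau>" "i \<le> j" "j \<le> K"
  shows "\<tau> i \<le> \<tau> j"
  using assms(2,3)
proof (induction rule: dec_induct)
  case (step n)
  have "\<forall>k\<in>{1..K}. \<tau> (k - 1) < \<tau> k" "Suc n \<in> {1..K}"
    using assms(1) step unfolding is_grid_def by auto
  then have "\<tau> (Suc n - 1) < \<tau> (Suc n)" by blast
  with step show ?case by simp
qed simp

lemma grid_cell:
  assumes grid: "is_grid T K \<tau>" and k: "k \<in> {1..K}"
  shows "{\<tau> (k - 1)..<\<tau> k} \<subseteq> {0..T}" "\<tau> k - \<tau> (k - 1) \<le> max_spacing K \<tau>" "\<tau> (k - 1) < \<tau> k"
proof -
  have "\<tau> 0 \<le> \<tau> (k - 1)" "\<tau> k \<le> \<tau> K" using k by (auto intro!: grid_mono[OF grid])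
  then show "{\<tau> (k - 1)..<\<tau> k} \<subseteq> {0..T}" using grid by (auto simp: is_grid_def)
  show "\<tau> k - \<tau> (k - 1) \<le> max_spacing K \<tau>"
    unfolding max_spacing_def using k by (intro Max_ge) auto
  show "\<tau> (k - 1) < \<tau> k" using grid k by (auto simp: is_grid_def)
qed

lemma grid_disjoint:
  assumes grid: "is_grid T K \<tau>" and "j \<in> {1..K}" "k \<in> {1..K}" "j \<noteq> k"
  shows "{\<tau> (j - 1)..<\<tau> j} \<inter> {\<tau> (k - 1)..<\<tau> k} = {}"
proof -
  have *: "{\<tau> (i - 1)..<\<tau> i} \<inter> {\<tau> (l - 1)..<\<tau> l} = {}" if "i < l" "l \<in> {1..K}" for i l
  proof -
    have "\<tau> i \<le> \<tau> (l - 1)" using that by (intro grid_mono[OF grid]) auto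
    then show ?thesis by auto
  qed
  show ?thesis
    using *[of j k] *[of k j] assms(2-4) by (metis Int_commute linorder_neqE_nat)
qed

lemma grid_cover:
  assumes grid: "is_grid T K \<tau>" and s: "0 \<le> s" "s < T"
  shows "\<exists>k\<in>{1..K}. s \<in> {\<tau> (k - 1)..<\<tau> k}"
proof -
  define k where "k = (LEAST k. s < \<tau> k)"
  have K: "s < \<tau> K" using grid s by (simp add: is_grid_def)
  have k: "s < \<tau> k" "k \<le> K" unfolding k_def using K by (auto intro: LeastI Least_le)
  have "\<tau> 0 = 0" using grid by (simp add: is_grid_def)
  then have "k \<noteq> 0" using k(1) s(1) by (metis not_less)
  then have "\<not> s < \<tau> (k - 1)" unfolding k_def by (intro not_less_Least) simp
  with k \<open>k \<noteq> 0\<close> show ?thesis by (intro bexI[of _ k]) auto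
qed

theorem mainTheorem5:
  fixes A :: "real^'n^'n" and B :: "real^'q^'n" and x0 :: "real^'n" and T :: real
    and xd :: "real \<Rightarrow> real^'n" and Q :: "real^'n^'n" and R :: "real^'q^'q"
  assumes "T > 0" and "L2_on T xd" and "sym_pos_semidef Q" and "sym_pos_def R"
  shows "\<exists>C::real. \<forall>(M::nat) (Am :: nat \<Rightarrow> real^'n^'n) (S :: nat \<Rightarrow> nat set) (p :: nat \<Rightarrow> real)
           (K::nat) (\<tau> :: nat \<Rightarrow> real) (ustar :: real \<Rightarrow> real^'q)
           (uh :: (nat \<Rightarrow> nat) \<Rightarrow> real \<Rightarrow> real^'q).
           A = (\<Sum>m=1..M. Am m) \<longrightarrow>
           enumerates_subsets M S \<longrightarrow>
           (\<forall>w\<in>{1..2^M}. 0 \<le> p w) \<longrightarrow>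
           is_grid T K \<tau> \<longrightarrow>
           (\<forall>m\<in>{1..M}. \<forall>x. x \<bullet> (Am m *v x) \<le> 0) \<longrightarrow>
           (\<Sum>w=1..2^M. p w) = 1 \<longrightarrow>
           (\<forall>m\<in>{1..M}. 0 < sel_prob M S p m) \<longrightarrow>
           is_arg_min (cost (\<lambda>_. A) B x0 Q R xd T) (L2_on T) ustar \<longrightarrow>
           (\<forall>\<omega>\<in>outcomes M K.
              is_arg_min (cost (A_h M S p Am K \<tau> \<omega>) B x0 Q R xd T) (L2_on T) (uh \<omega>)) \<longrightarrow>
           expect M K p (\<lambda>\<omega>. \<bar>cost (\<lambda>_. A) B x0 Q R xd T (uh \<omega>) - cost (\<lambda>_. A) B x0 Q R xd T ustar\<bar>)
             \<le> C * max_spacing K \<tau> * Var_split M S p Am A"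
proof -
  have T: "0 \<le> T" and symQ: "transpose Q = Q" and Q0: "\<And>x. 0 \<le> x \<bullet> (Q *v x)" and symR: "transpose R = R"
    using assms by (auto simp: sym_pos_semidef_def sym_pos_def_def)
  note xd = \<open>L2_on T xd\<close>
  obtain \<alpha> where \<alpha>: "\<alpha> > 0" "\<And>x. \<alpha> * (norm x)\<^sup>2 \<le> x \<bullet> (R *v x)"
    using sym_pos_def_coercive[OF assms(4)] by blast
  define q b r where "q = onorm ((*v) Q)" and "b = onorm ((*v) B)" and "r = onorm ((*v) R)"
  note q0 = onorm_matrix_nonneg[of Q, folded q_def] and b0 = onorm_matrix_nonneg[of B, folded b_def]
    and r0 = onorm_matrix_nonneg[of R, folded r_def]
  define D where "D = (4 * q * b\<^sup>2 * T\<^sup>2 + r) / \<alpha>\<^sup>2 * (4 * q\<^sup>2 * b\<^sup>2 * T\<^sup>2 + b\<^sup>2)"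
  \<comment> \<open>\<open>U\<close> bounds the \<open>L\<^sup>1\<close> norm of every minimizer of \<open>J\<close>, and \<open>C1\<close> and \<open>C2\<close> bound the states and
    adjoint states that belong to it. All three depend on the data only.\<close>
  define U where "U = T + 2 / \<alpha> * cost (\<lambda>_. A) B x0 Q R xd T (\<lambda>_. 0)"
  define C1 where "C1 = norm x0 + 2 * (b * U)"
  define C2 where "C2 = 2 * (q * (T * C1 + (LINT s|lebesgue_on {0..T}. norm (xd s))))"
  have D0: "0 \<le> D" unfolding D_def using q0 r0 by simp
  show ?thesis
  proof (rule exI[of _ "D * (T * (4 * C1\<^sup>2 * T) + T * (4 * C2\<^sup>2 * T))"], intro allI impI)
    fix M :: nat and Am :: "nat \<Rightarrow> real^'n^'n" and S :: "nat \<Rightarrow> nat set" and p :: "nat \<Rightarrow> real"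
      and K :: nat and \<tau> :: "nat \<Rightarrow> real" and u :: "real \<Rightarrow> real^'q" and uh :: "(nat \<Rightarrow> nat) \<Rightarrow> real \<Rightarrow> real^'q"
    assume A_sum: "A = (\<Sum>m=1..M. Am m)" and S: "enumerates_subsets M S"
      and p: "\<forall>w\<in>{1..2^M}. 0 \<le> p w" and grid: "is_grid T K \<tau>"
      and Am: "\<forall>m\<in>{1..M}. \<forall>x. x \<bullet> (Am m *v x) \<le> 0" and p1: "(\<Sum>w=1..2^M. p w) = 1"
      and pos: "\<forall>m\<in>{1..M}. 0 < sel_prob M S p m"
      and u: "is_arg_min (cost (\<lambda>_. A) B x0 Q R xd T) (L2_on T) u"
      and uh: "\<forall>\<xi>\<in>outcomes M K. is_arg_min (cost (A_h M S p Am K \<tau> \<xi>) B x0 Q R xd T) (L2_on T) (uh \<xi>)"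
    define X where "X = sampled_matrix M S p Am"
    define h where "h = max_spacing K \<tau>"
    define \<delta> where "\<delta> w = onorm ((*v) (X w - A))" for w
    define V where "V = (\<Sum>w=1..2^M. p w * (\<delta> w)\<^sup>2)"
    have V: "Var_split M S p Am A = V"
      unfolding Var_split_def V_def \<delta>_def X_def by (simp add: mult.commute)
    have Ssub: "S w \<subseteq> {1..M}" if "w \<in> {1..2^M}" for w
      using S that bij_betwE unfolding enumerates_subsets_def by blast
    have dX: "\<forall>w\<in>{1..2^M}. dissipative (X w)"
    proof
      fix w assume w: "w \<in> {1..2^M::nat}"
      show "dissipative (X w)"
        unfolding X_def
        by (rule sampled_matrix_dissipative[where S=S, OF Ssub[OF w]]) (use Am pos in \<open>auto simp: dissipative_def\<close>)
    qed
    have mean: "(\<Sum>w=1..2^M. p w *\<^sub>R X w) = A"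
      unfolding X_def A_sum using Ssub pos by (intro sampled_matrix_mean) auto
    have dA: "dissipative A"
      unfolding dissipative_def
    proof
      fix x
      from linear_sum[OF linear_inner_matrix] have "x \<bullet> (A *v x) = (\<Sum>m=1..M. x \<bullet> (Am m *v x))"
        unfolding A_sum .
      also have "\<dots> \<le> 0" using Am by (intro sum_nonpos) auto
      finally show "x \<bullet> (A *v x) \<le> 0" .
    qed
    have A: "admissible (\<lambda>_. A)" by (rule admissible_const[OF dA])
    have \<delta>: "\<forall>w\<in>{1..2^M}. \<forall>v. norm ((X w - A) *v v) \<le> \<delta> w * norm v"
      unfolding \<delta>_def using norm_matrix_vector_le by blast
    define I where "I k = {\<tau> (k - 1)..<\<tau> k}" for k
    define F where "F \<xi> = piecewise I K (\<lambda>k. X (\<xi> k))" for \<xi> :: "nat \<Rightarrow> nat"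
    have F_eq: "A_h M S p Am K \<tau> \<xi> = F \<xi>" for \<xi>
      unfolding F_def I_def X_def by (rule ext) (simp add: A_h_def piecewise_def)
    have I: "\<forall>k\<in>{1..K}. I k \<in> sets lebesgue \<and> I k \<subseteq> {0..T} \<and> measure lebesgue (I k) \<le> h"
    proof (intro ballI conjI)
      fix k assume k: "k \<in> {1..K}"
      show "I k \<in> sets lebesgue" unfolding I_def by simp
      show "I k \<subseteq> {0..T}" unfolding I_def by (rule grid_cell(1)[OF grid k])
      show "measure lebesgue (I k) \<le> h"
        unfolding I_def h_def using grid_cell(2,3)[OF grid k] by simp
    qed
    have I_disj: "\<forall>j\<in>{1..K}. \<forall>k\<in>{1..K}. j \<noteq> k \<longrightarrow> I j \<inter> I k = {}"
      unfolding I_def using grid_disjoint[OF grid] by blast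
    \<comment> \<open>The cells miss the endpoint \<open>T\<close>, where the sampled coefficient is \<open>0\<close>.\<close>
    have I_cover: "AE s in lebesgue_on {0..T}. \<exists>k\<in>{1..K}. s \<in> I k"
      by (rule lebesgue_on_mono[OF AE_interval_neq[of T T]]) (use grid_cover[OF grid] in \<open>auto simp: I_def\<close>)
    have "K \<noteq> 0" using grid assms(1) unfolding is_grid_def by (metis less_irrefl)
    then have h0: "0 \<le> h"
      unfolding h_def using grid_cell(2,3)[OF grid, of 1] by fastforce
    have F: "admissible (F \<xi>)" if "\<xi> \<in> outcomes M K" for \<xi>
      unfolding F_def
    proof (rule admissible_piecewise)
      fix k assume k: "k \<in> {1..K}"
      then show "I k \<in> sets lebesgue" using I by blast
      have "\<xi> k \<in> {1..2^M}" using that k unfolding outcomes_def by (rule PiE_mem)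
      then show "dissipative (X (\<xi> k))" using dX by blast
    qed
    have uL2: "L2_on T u" using u by (simp add: is_arg_min_def)
    have Bu: "integrable (lebesgue_on {0..T}) (\<lambda>s. B *v u s)" by (rule L2_on_source[OF uL2])
    have C1: "norm x0 + 2 * (LINT s|lebesgue_on {0..T}. norm (B *v u s)) \<le> C1"
    proof -
      have "(LINT s|lebesgue_on {0..T}. norm (B *v u s)) \<le> (LINT s|lebesgue_on {0..T}. b * norm (u s))"
        using Bu L2_on_integrable[OF uL2] norm_matrix_vector_le[of B] by (intro integral_mono) (auto simp: b_def)
      also have "\<dots> = b * (LINT s|lebesgue_on {0..T}. norm (u s))" by simp
      also have "\<dots> \<le> b * U"
        using minimizer_L1_bound[OF A assms(1) xd Q0 \<alpha> u] b0 unfolding U_def by (intro mult_left_mono)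
      finally show ?thesis by (simp add: C1_def)
    qed
    define x where "x = state (\<lambda>_. A) B x0 T u"
    define g where "g s = Q *v (x s - xd s)" for s
    have xL2: "L2_on T x" unfolding x_def by (rule L2_on_state[OF A T uL2])
    have gint: "integrable (lebesgue_on {0..T}) g"
      unfolding g_def by (intro L2_on_source L2_on_diff xL2 xd)
    have state_error: "expect M K p (\<lambda>\<xi>. (norm (state (F \<xi>) B x0 T u t - x t))\<^sup>2) \<le> 4 * C1\<^sup>2 * h * T * V"
      if "t \<in> {0..T}" for t
      unfolding F_def x_def V_def
      by (rule mean_square_state_error[OF p p1 mean dX dA \<delta> I I_disj I_cover h0 that Bu C1])

    let ?I = "\<lambda>k. {s. T - s \<in> I k}"
    have adjoint_error: "expect M K p (\<lambda>\<xi>. (norm (adjoint_state (F \<xi>) T g t - adjoint_state (\<lambda>_. A) T g t))\<^sup>2)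
        \<le> 4 * C2\<^sup>2 * h * T * V" if t: "t \<in> {0..T}" for t
      unfolding adjoint_state_def F_def transpose_piecewise V_def
    proof (rule mean_square_state_error[OF p p1, where \<delta> = \<delta>])
      show "(\<Sum>w=1..2^M. p w *\<^sub>R transpose (X w)) = transpose A"
        unfolding mean[symmetric] linear_sum[OF linear_transpose] by (simp add: transpose_scalar)
      show "\<forall>w\<in>{1..2^M}. dissipative (transpose (X w))" "dissipative (transpose A)"
        using dX dA by (auto intro: dissipative_transpose)
      show "\<forall>w\<in>{1..2^M}. \<forall>v. norm ((transpose (X w) - transpose A) *v v) \<le> \<delta> w * norm v"
        unfolding linear_diff[OF linear_transpose, symmetric] using \<delta> norm_transpose_le by blast
      have I_eq: "?I k = {T - \<tau> k<..T - \<tau> (k - 1)}" for k by (auto simp: I_def)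
      show "\<forall>k\<in>{1..K}. ?I k \<in> sets lebesgue \<and> ?I k \<subseteq> {0..T} \<and> measure lebesgue (?I k) \<le> h"
      proof (intro ballI conjI)
        fix k assume k: "k \<in> {1..K}"
        show "?I k \<in> sets lebesgue" unfolding I_eq by simp
        show "?I k \<subseteq> {0..T}" using I k by fastforce
        show "measure lebesgue (?I k) \<le> h"
          unfolding I_eq h_def using grid_cell(2,3)[OF grid k] by simp
      qed
      show "\<forall>j\<in>{1..K}. \<forall>k\<in>{1..K}. j \<noteq> k \<longrightarrow> ?I j \<inter> ?I k = {}"
        using I_disj by blast
      show "AE s in lebesgue_on {0..T}. \<exists>k\<in>{1..K}. s \<in> ?I k"
        by (rule lebesgue_on_mono[OF AE_interval_neq[of 0 T]]) (use grid_cover[OF grid] in \<open>auto simp: I_def\<close>)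
      show "T - t \<in> {0..T}" using t by auto
      show "integrable (lebesgue_on {0..T}) (\<lambda>s. mat 1 *v g (T - s))"
        using reflect_integral(1)[OF gint] by simp
      have "(LINT s|lebesgue_on {0..T}. norm (g (T - s))) = (LINT s|lebesgue_on {0..T}. norm (g s))"
        using reflect_integral(2)[of T "\<lambda>s. norm (g s)" T] gint T integral_eq_zero_null_sets[of "{0::real}"] by simp
      also have "\<dots> \<le> (LINT s|lebesgue_on {0..T}. q * (C1 + norm (xd s)))"
      proof (rule integral_mono)
        fix s assume "s \<in> space (lebesgue_on {0..T})"
        then have "norm (x s) \<le> C1"
          using state_bound[OF A _ Bu, of s x0] C1 unfolding x_def by force
        then have "norm (x s - xd s) \<le> C1 + norm (xd s)"
          using norm_triangle_ineq4[of "x s" "xd s"] by linarith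
        then have "q * norm (x s - xd s) \<le> q * (C1 + norm (xd s))"
          using q0 by (rule mult_left_mono)
        then show "norm (g s) \<le> q * (C1 + norm (xd s))"
          using norm_matrix_vector_le[of Q "x s - xd s"] unfolding g_def q_def by linarith
      qed (use gint L2_on_integrable[OF xd] in auto)
      also have "\<dots> = q * (T * C1 + (LINT s|lebesgue_on {0..T}. norm (xd s)))"
        using L2_on_integrable[OF xd] integral_const_interval[OF T, of C1] by simp
      finally show "norm (0::real^'n) + 2 * (LINT s|lebesgue_on {0..T}. norm (mat 1 *v g (T - s))) \<le> C2"
        by (simp add: C2_def)
    qed (use h0 in auto)

    define e \<eta> where "e \<xi> t = (norm (state (F \<xi>) B x0 T u t - x t))\<^sup>2"
      and "\<eta> \<xi> t = (norm (adjoint_state (F \<xi>) T g t - adjoint_state (\<lambda>_. A) T g t))\<^sup>2" for \<xi> t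
    have e_int: "integrable (lebesgue_on {0..T}) (e \<xi>)" and \<eta>_int: "integrable (lebesgue_on {0..T}) (\<eta> \<xi>)"
      if "\<xi> \<in> outcomes M K" for \<xi>
    proof -
      show "integrable (lebesgue_on {0..T}) (e \<xi>)"
        unfolding e_def by (intro L2_on_norm_square L2_on_diff L2_on_state F that T uL2 xL2)
      show "integrable (lebesgue_on {0..T}) (\<eta> \<xi>)"
        unfolding \<eta>_def by (intro L2_on_norm_square L2_on_diff L2_on_continuous
          primitive_on_continuous[OF adjoint_state_primitive(1)] F that A T gint)
    qed
    have "expect M K p (\<lambda>\<xi>. \<bar>cost (\<lambda>_. A) B x0 Q R xd T (uh \<xi>) - cost (\<lambda>_. A) B x0 Q R xd T u\<bar>)
        \<le> expect M K p (\<lambda>\<xi>. D * ((LINT t|lebesgue_on {0..T}. e \<xi> t) + (LINT t|lebesgue_on {0..T}. \<eta> \<xi> t)))"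
    proof (rule expect_mono[OF p])
      fix \<xi> assume \<xi>: "\<xi> \<in> outcomes M K"
      have w: "is_arg_min (cost (F \<xi>) B x0 Q R xd T) (L2_on T) (uh \<xi>)"
        using uh \<xi> by (simp add: F_eq)
      have g_eq: "g = (\<lambda>s. Q *v (state (\<lambda>_. A) B x0 T u s - xd s))"
        by (simp add: g_def x_def fun_eq_iff)
      show "\<bar>cost (\<lambda>_. A) B x0 Q R xd T (uh \<xi>) - cost (\<lambda>_. A) B x0 Q R xd T u\<bar> \<le>
          D * ((LINT t|lebesgue_on {0..T}. e \<xi> t) + (LINT t|lebesgue_on {0..T}. \<eta> \<xi> t))"
        unfolding D_def q_def b_def r_def e_def \<eta>_def g_eq x_def
        by (rule minimizer_cost_difference[OF A F[OF \<xi>] assms(1) xd symQ symR Q0 \<alpha> u w])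
    qed
    also have "\<dots> = D * (expect M K p (\<lambda>\<xi>. LINT t|lebesgue_on {0..T}. e \<xi> t)
        + expect M K p (\<lambda>\<xi>. LINT t|lebesgue_on {0..T}. \<eta> \<xi> t))"
      by (simp only: expect_cmult expect_add)
    also have "\<dots> \<le> D * (T * (4 * C1\<^sup>2 * h * T * V) + T * (4 * C2\<^sup>2 * h * T * V))"
      using state_error adjoint_error D0
      by (intro mult_left_mono add_mono expect_integral_le p T e_int \<eta>_int) (auto simp: e_def \<eta>_def)
    also have "\<dots> = D * (T * (4 * C1\<^sup>2 * T) + T * (4 * C2\<^sup>2 * T)) * h * V"
      by (simp add: algebra_simps)
    finally show "expect M K p (\<lambda>\<omega>. \<bar>cost (\<lambda>_. A) B x0 Q R xd T (uh \<omega>) - cost (\<lambda>_. A) B x0 Q R xd T u\<bar>)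
        \<le> D * (T * (4 * C1\<^sup>2 * T) + T * (4 * C2\<^sup>2 * T)) * max_spacing K \<tau> * Var_split M S p Am A"
      unfolding V h_def .
  qed
qed

end
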